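(* (i) Let $r\ge 2$ and let $T$ be any complete balanced $r$-partite graph. There exists $n_0$ such that for all $n\ge n_0$, the Turán graph $T_r(n)$ is the unique (up to isomorphism) $n$-vertex $K_{r+1}$-free graph which maximizes the number of copies of $T$ among all $n$-vertex $K_{r+1}$-free graphs. (ii) Let $t\ge s\ge 1$ be integers. There exists $n_0$ such that for all $n\ge n_0$: $T_2(n)$ maximizes the number of copies of $K_{s,t}$ among all $n$-vertex triangle-free graphs if and only if $t<s+\frac12+\sqrt{2s+\frac14}$.
   Context: All graphs are finite and simple. The number of copies of $T$ in $G$ is the number of (not necessarily induced) subgraphs of $G$ isomorphic to $T$. A complete $r$-partite graph (with $r$ nonempty parts) is balanced if its part sizes differ by at most one. The Turán graph $T_r(n)$ is the complete balanced $r$-partite graph on $n$ vertices. $K_{s,t}$ is the complete bipartite graph with parts of sizes $s$ and $t$. *)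

theory Defs
  imports Complex_Main "HOL-Library.Disjoint_Sets" "Graph_Theory.Graph_Theory"
begin

text \<open>
  A finite simple graph is a \<open>pair_graph\<close>: a finite vertex set together with a finite, symmetric,
  irreflexive relation on it. Each undirected edge \<open>uv\<close> is the pair of arcs \<open>(u,v)\<close>, \<open>(v,u)\<close>.
\<close>

text \<open>
  A subgraph isomorphic to a \<open>pair_graph\<close> is automatically symmetric, so the set below is in
  bijection with the undirected (not necessarily induced) subgraphs of \<open>G\<close> isomorphic to \<open>T\<close>.
\<close>

definition num_copies :: "'a pair_pre_digraph \<Rightarrow> 'b pair_pre_digraph \<Rightarrow> nat" where
  "num_copies T G =
     card {H :: 'b pair_pre_digraph.
             subgraph (with_proj H) (with_proj G) \<and> digraph_iso (with_proj T) (with_proj H)}"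

definition clique_free :: "nat \<Rightarrow> 'a pair_pre_digraph \<Rightarrow> bool" where
  "clique_free k G \<longleftrightarrow>
     \<not> (\<exists>H :: 'a pair_pre_digraph.
           subgraph (with_proj H) (with_proj G) \<and> complete_digraph k (with_proj H))"

text \<open>Parts are nonempty, by \<open>partition_on\<close>.\<close>

definition complete_balanced_partite :: "nat \<Rightarrow> 'a pair_pre_digraph \<Rightarrow> bool" where
  "complete_balanced_partite r G \<longleftrightarrow> pair_graph G \<and>
     (\<exists>P. partition_on (pverts G) P \<and> card P = r \<and>
          parcs G = {(u, v). u \<in> pverts G \<and> v \<in> pverts G \<and> \<not> (\<exists>A\<in>P. u \<in> A \<and> v \<in> A)} \<and>
          (\<forall>A\<in>P. \<forall>B\<in>P. card A \<le> card B + 1))"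

text \<open>The parts are the residue classes modulo \<open>r\<close>, see \<open>complete_balanced_partite_turan_graph\<close>.\<close>

definition turan_graph :: "nat \<Rightarrow> nat \<Rightarrow> nat pair_pre_digraph" where
  "turan_graph r n =
     \<lparr> pverts = {..<n}, parcs = {(i, j). i < n \<and> j < n \<and> i mod r \<noteq> j mod r} \<rparr>"

lemma card_pverts_turan_graph: "card (pverts (turan_graph r n)) = n"
  by (simp add: turan_graph_def)

lemma complete_balanced_partite_turan_graph:
  assumes "1 \<le> r" "r \<le> n"
  shows "complete_balanced_partite r (turan_graph r n)"
proof -
  let ?G = "turan_graph r n"
  define C where "C k = {i. i < n \<and> i mod r = k}" for k
  have fin: "finite (parcs ?G)"
    by (rule finite_subset[of _ "{..<n} \<times> {..<n}"]) (auto simp: turan_graph_def)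
  have "pair_graph ?G"
    using fin by unfold_locales (auto simp: turan_graph_def symmetric_def intro!: symI)
  moreover have "partition_on (pverts ?G) (C ` {..<r})"
  proof (rule partition_onI)
    show "\<Union> (C ` {..<r}) = pverts ?G"
      using assms by (auto simp: C_def turan_graph_def)
    have "k \<in> C k" if "k < r" for k using assms that by (simp add: C_def)
    then show "{} \<notin> C ` {..<r}" by fastforce
  qed (auto simp: C_def disjnt_def)
  moreover have "card (C ` {..<r}) = r"
  proof -
    have "inj_on C {..<r}"
    proof (rule inj_onI)
      fix k l assume kl: "k \<in> {..<r}" "l \<in> {..<r}" "C k = C l"
      have "k \<in> C k" using assms kl(1) by (simp add: C_def)
      then have "k \<in> C l" using kl(3) by blast
      then show "k = l" using kl(1) by (simp add: C_def)
    qed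
    then show ?thesis by (simp add: card_image)
  qed
  moreover have "parcs ?G =
      {(u, v). u \<in> pverts ?G \<and> v \<in> pverts ?G \<and> \<not> (\<exists>A\<in>C ` {..<r}. u \<in> A \<and> v \<in> A)}"
    using assms by (auto simp: C_def turan_graph_def)
  moreover have "card (C k) \<le> card (C l) + 1" if "k < r" "l < r" for k l
  proof -
    have finC: "finite (C m)" for m by (simp add: C_def)
    define f where "f i = (i div r - 1) * r + l" for i
    have pos: "0 < i div r" if "i \<in> C k - {k}" for i
    proof (rule ccontr)
      assume "\<not> 0 < i div r"
      then have "i mod r = i" by (metis div_mult_mod_eq mult_0 add_0 neq0_conv)
      with that show False by (simp add: C_def)
    qed
    have "inj_on f (C k - {k})"
    proof (rule inj_onI)
      fix i j assume ij: "i \<in> C k - {k}" "j \<in> C k - {k}" "f i = f j"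
      then have "i div r - 1 = j div r - 1" using assms by (simp add: f_def)
      with pos[OF ij(1)] pos[OF ij(2)] have "i div r = j div r" by linarith
      moreover have "i mod r = j mod r" using ij by (simp add: C_def)
      ultimately show "i = j" by (metis div_mult_mod_eq)
    qed
    moreover have "f ` (C k - {k}) \<subseteq> C l"
    proof
      fix x assume "x \<in> f ` (C k - {k})"
      then obtain i where i: "i \<in> C k - {k}" "x = f i" by blast
      obtain q where q: "i div r = Suc q" using pos[OF i(1)] gr0_implies_Suc by blast
      have "x = q * r + l" using i q by (simp add: f_def)
      moreover have "Suc q * r \<le> i" using q by (metis div_times_less_eq_dividend)
      moreover have "i < n" using i by (simp add: C_def)
      ultimately show "x \<in> C l" using \<open>l < r\<close> by (simp add: C_def)
    qed
    ultimately have "card (C k - {k}) \<le> card (C l)"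
      using finC card_inj_on_le by blast
    then show ?thesis using finC[of k] by (auto simp: card_Diff_singleton_if split: if_splits)
  qed
  ultimately show ?thesis
    unfolding complete_balanced_partite_def by blast
qed

text \<open>
  Every finite graph has an isomorphic copy on vertices in \<^typ>\<open>nat\<close>, so letting \<open>G\<close> and its
  competitors range over that type loses no graphs.
\<close>

definition maximizes_copies :: "'a pair_pre_digraph \<Rightarrow> nat \<Rightarrow> nat \<Rightarrow> nat pair_pre_digraph \<Rightarrow> bool" where
  "maximizes_copies T k n G \<longleftrightarrow>
     pair_graph G \<and> card (pverts G) = n \<and> clique_free k G \<and>
     (\<forall>H :: nat pair_pre_digraph.
        pair_graph H \<and> card (pverts H) = n \<and> clique_free k H \<longrightarrow> num_copies T H \<le> num_copies T G)"

end

theory Submission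
  imports Defs
begin

text \<open>
  Zykov's symmetrization carries the whole proof. A copy of a complete multipartite graph \<open>T\<close> is
  determined by its parts, so copies are counted as families of vertex sets whose cardinalities form
  the multiset of part sizes of \<open>T\<close> and any two of which are completely joined. If \<open>u\<close> and \<open>v\<close> are
  non-adjacent, then a copy that contains both has them in the same part, hence it survives when the
  neighbourhood of \<open>u\<close> is replaced by that of \<open>v\<close>. Copies that contain only \<open>u\<close> are exchanged for
  duplicates of the copies that contain only \<open>v\<close>. So one of the two ways of cloning does not lose
  copies, and in a graph with the maximum number of copies neither does: \<open>extremal_clone\<close>. Cloning
  the vertex that has more twins increases the number of pairs of twins
  (\<open>card_twin_pairs_clone\<close>), so repeated cloning ends in a graph in which non-adjacent vertices are
  twins. Such a \<open>K\<^sub>r\<^sub>+\<^sub>1\<close>-free graph is given by an \<open>r\<close>-colouring, two vertices being adjacent iff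
  their colours differ.

  In a coloured graph a copy of an \<open>r\<close>-partite \<open>T\<close> is just a vertex set that meets the colour
  classes in the part sizes of \<open>T\<close>. Fixing its trace outside two classes with \<open>a\<close> and \<open>b\<close> vertices,
  the number of completions is
  \<open>pair_choices p q a b = (a choose p) (b choose q) + (a choose q) (b choose p)\<close> for two part sizes
  \<open>p \<noteq> q\<close>, and \<open>(a choose p) (b choose p)\<close> if they are equal. Everything depends on whether this
  grows when a vertex moves from the larger class to the smaller one. If \<open>p\<close> and \<open>q\<close> differ by at
  most one, it does (\<open>pair_choices_balance_consecutive\<close>). For the sizes \<open>s\<close> and \<open>s + k\<close> with
  \<open>k = m + 1\<close>, put \<open>a = P + 1 + s\<close> and \<open>b = Q + s\<close>; then the sign of the change is that of
  \<open>s (P - Q) ((P choose k) + (Q + 1 choose k)) - (P + 1 + s) (Q + 1) ((P choose m) - (Q choose m))\<close>.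
  The exact inequality \<open>choose_diff_trapezoid\<close> bounds the subtracted term; it is an equality for
  \<open>P - Q \<le> 2\<close>. This makes \<open>m k < 2 s\<close> sufficient for balancing to pay off once \<open>P\<close> is large, and
  \<open>m k \<ge> 2 s\<close> sufficient for a single step away from the Turan graph to gain copies. The condition
  on \<open>t\<close> in the theorem is \<open>m k < 2 s\<close> solved for \<open>t = s + k\<close>.

  Uniqueness follows the cloning backwards (\<open>extremal_is_balanced_colouring\<close>): if cloning \<open>v\<close> over
  \<open>u\<close> turns an extremal graph \<open>G\<close> into a balanced coloured graph, then \<open>G\<close> itself is a subgraph of
  a coloured graph, since otherwise \<open>u\<close> would have neighbours of all \<open>r\<close> colours. Every edge of a
  balanced coloured graph with large classes lies in a copy of \<open>T\<close>, so \<open>G\<close> misses no edge.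
\<close>

section \<open>Choosing two subsets of prescribed sizes\<close>

text \<open>
  The number of pairs of subsets, one in each of two disjoint sets with \<open>a\<close> and \<open>b\<close> elements, that
  have sizes \<open>p\<close> and \<open>q\<close> in some order. The two orders are counted once if \<open>p = q\<close>.
\<close>

definition pair_choices :: "nat \<Rightarrow> nat \<Rightarrow> nat \<Rightarrow> nat \<Rightarrow> nat" where
  "pair_choices p q a b =
     (if p = q then (a choose p) * (b choose p)
      else (a choose p) * (b choose q) + (a choose q) * (b choose p))"

lemma pair_choices_commute: "pair_choices p q a b = pair_choices q p a b"
  by (simp add: pair_choices_def)

lemma Suc_choose_step: "Suc k * (n choose Suc k) = (n - k) * (n choose k)"
  by (simp only: binomial_absorption binomial_absorb_comp)

text \<open>
  By Pascal's rule only the terms \<open>(a choose p - 1) (b choose p)\<close> and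
  \<open>(a choose p) (b choose p - 1)\<close> differ, and their ratio is \<open>(b - p + 1) / (a - p + 1)\<close>.
\<close>

lemma choose_mult_strict_balance:
  assumes "1 \<le> p" "p \<le> b" "b < a"
  shows "(Suc a choose p) * (b choose p) < (a choose p) * (Suc b choose p)"
proof -
  obtain p' where p: "p = Suc p'" using assms(1) by (cases p) auto
  have pos: "0 < (a choose p') * (b choose p')" using assms p by simp
  have "Suc p' * ((a choose p') * (b choose Suc p')) = (b - p') * ((a choose p') * (b choose p'))"
    using Suc_choose_step[of p' b] by (metis mult.left_commute)
  also have "\<dots> < (a - p') * ((a choose p') * (b choose p'))"
    using pos assms p by (intro mult_strict_right_mono) auto
  also have "\<dots> = Suc p' * ((a choose Suc p') * (b choose p'))"
    using Suc_choose_step[of p' a] by (metis mult.assoc)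
  finally have "(a choose p') * (b choose Suc p') < (a choose Suc p') * (b choose p')"
    by (metis mult_less_cancel1)
  then show ?thesis by (simp add: p algebra_simps)
qed

text \<open>
  For \<open>q = p + 1\<close> the sum of the two products is
  \<open>(a choose p) (b choose p) (a + b - 2 p) / (p + 1)\<close>, and \<open>a + b\<close> is unchanged by the move, so the
  claim reduces to the case of equal sizes.
\<close>

lemma pair_choices_balance_consecutive:
  assumes "1 \<le> k" "p \<in> {k, Suc k}" "q \<in> {k, Suc k}" "b < a"
    and pos: "0 < pair_choices p q (Suc a) b"
  shows "pair_choices p q (Suc a) b < pair_choices p q a (Suc b)"
proof (cases "p = q")
  case True
  with pos have "p \<le> b" by (auto simp: pair_choices_def)
  with True assms show ?thesis
    using choose_mult_strict_balance[of p b a] by (auto simp: pair_choices_def)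
next
  case False
  have eq: "pair_choices p q x y = pair_choices k (Suc k) x y" for x y
    using False assms(2,3) by (auto simp: pair_choices_def)
  have kb: "k \<le> b"
  proof (rule ccontr)
    assume "\<not> k \<le> b"
    then show False using pos unfolding eq by (simp add: pair_choices_def)
  qed
  have *: "Suc k * pair_choices k (Suc k) x y = (x + y - 2 * k) * ((x choose k) * (y choose k))"
    if "k \<le> x" "k \<le> y" for x y
  proof -
    have "Suc k * pair_choices k (Suc k) x y =
        (x choose k) * (Suc k * (y choose Suc k)) + (Suc k * (x choose Suc k)) * (y choose k)"
      by (simp add: pair_choices_def algebra_simps)
    also have "\<dots> = ((y - k) + (x - k)) * ((x choose k) * (y choose k))"
      unfolding Suc_choose_step by (simp add: algebra_simps)
    also have "(y - k) + (x - k) = x + y - 2 * k" using that by simp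
    finally show ?thesis .
  qed
  have "Suc k * pair_choices k (Suc k) (Suc a) b < Suc k * pair_choices k (Suc k) a (Suc b)"
    using * [of "Suc a" b] * [of a "Suc b"] kb assms
      choose_mult_strict_balance[of k b a] by simp
  then show ?thesis unfolding eq by (simp only: mult_less_cancel1)
qed

lemma choose_le_choose: "a \<le> b \<Longrightarrow> (a choose k) \<le> (b choose k)"
proof (induction b rule: dec_induct)
  case (step n)
  then show ?case by (cases k) auto
qed simp

text \<open>
  Convexity of \<open>x \<mapsto> (x choose e)\<close>: its increments \<open>(x choose e - 1)\<close> are monotone.
\<close>

lemma choose_convex:
  "(x + d choose e) + (y choose e) \<le> (y + d choose e) + (x choose e)" if "x \<le> y"
proof (cases e)
  case (Suc e')
  have "(x + d choose e) + (y choose e) \<le> (y + d choose e) + (x choose e)"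
  proof (induction d)
    case (Suc d)
    have "(x + d choose e') \<le> (y + d choose e')" using that by (simp add: choose_le_choose)
    with Suc show ?case by (simp add: \<open>e = Suc e'\<close>)
  qed simp
  then show ?thesis .
qed simp

lemma choose_absorb_twice:
  assumes "1 \<le> m"
  shows "real m * real (Suc m) * real (n choose Suc m) =
    real n * (real n - real m) * real (n - 1 choose (m - 1))"
proof (cases "m \<le> n")
  case True
  obtain m' where m: "m = Suc m'" using assms by (cases m) auto
  have 1: "real (Suc m) * real (n choose Suc m) = (real n - real m) * real (n choose m)"
    using Suc_choose_step[of m n] True by (metis of_nat_diff of_nat_mult)
  have 2: "real m * real (n choose m) = real n * real (n - 1 choose (m - 1))"
    using binomial_absorption[of m' n] m by (metis of_nat_mult diff_Suc_1)
  have "real m * real (Suc m) * real (n choose Suc m) = real m * ((real n - real m) * real (n choose m))"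
    using 1 by (simp only: mult.assoc)
  also have "\<dots> = (real n - real m) * (real m * real (n choose m))" by simp
  finally show ?thesis unfolding 2 by simp
next
  case False
  then have zero: "n choose Suc m = 0" by simp
  have "real n = 0 \<or> real (n - 1 choose (m - 1)) = 0" using False by (cases n) auto
  then show ?thesis
    unfolding zero by (elim disjE) (simp_all only: of_nat_0 mult_zero_left mult_zero_right)
qed

lemma pred_times_choose:
  assumes "1 \<le> m" "m < P"
  shows "(real P - 1) * real (P - 2 choose (m - 1)) = (real P - real m) * real (P - 1 choose (m - 1))"
proof -
  have "(P - 1 - (m-1)) * (P - 1 choose (m-1)) = (P - 1) * (P - 2 choose (m-1))"
    using binomial_absorb_comp[of "P-1" "m-1"] by (simp add: numeral_2_eq_2)
  moreover have "P - 1 - (m - 1) = P - m" using assms by simp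
  ultimately have "real (P - m) * real (P - 1 choose (m-1)) = real (P - 1) * real (P - 2 choose (m-1))"
    by (metis of_nat_mult)
  then show ?thesis using assms by simp
qed

lemma choose_diff_telescope:
  "real (Q + d choose Suc e) - real (Q choose Suc e) = (\<Sum>i<d. real (Q + i choose e))"
  by (induction d) auto

text \<open>
  The difference on the left is the sum of \<open>(j choose m - 1)\<close> over \<open>Q \<le> j < P\<close>. As for the
  trapezoidal rule, convexity bounds it by \<open>P - Q\<close> times the mean of the two extreme summands,
  and the extreme summands are then compared with the right-hand side by absorption.
\<close>

lemma choose_diff_trapezoid:
  assumes "1 \<le> m" "m < P" "Q < P"
  shows "2 * (real P - real m) * (real Q + 1) * (real (P choose m) - real (Q choose m))
     \<le> real m * real (Suc m) * (real P - real Q) * (real (P choose Suc m) + real (Suc Q choose Suc m))"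
proof -
  obtain m' where m: "m = Suc m'" using assms by (cases m) auto
  define d where "d = P - Q"
  have P: "P = Q + d" and d: "1 \<le> d" using assms by (auto simp: d_def)
  define c where "c j = real (j choose m')" for j
  define R where "R = real m * real (Suc m) * (real (P choose Suc m) + real (Suc Q choose Suc m))"
  \<comment> \<open>the first and the last summand together are bounded by the right-hand side per unit of \<open>d\<close>\<close>
  have ends: "(real P - real m) * (real Q + 1) * (c (P - 1) + c Q) \<le> R"
  proof -
    have R: "R = real P * (real P - real m) * c (P - 1) + (real Q + 1) * (real Q + 1 - real m) * c Q"
      unfolding R_def distrib_left choose_absorb_twice[OF assms(1)] by (simp add: c_def m)
    have "0 \<le> (real P - real Q - 1) * ((real P - real m) * c (P - 1) - (real Q + 1) * c Q)"
    proof (cases "P = Suc Q")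
      case False
      then have "Suc Q \<le> P - 1" using assms by simp
      then have "real (Suc Q) * real (Q choose m') \<le> real (P - 1) * real (P - 2 choose m')"
        using assms by (intro mult_mono of_nat_mono choose_le_choose) auto
      also have "\<dots> = (real P - real m) * c (P - 1)"
        using pred_times_choose[OF assms(1,2)] assms by (simp add: c_def m of_nat_diff)
      finally have "(real Q + 1) * c Q \<le> (real P - real m) * c (P - 1)" by (simp add: c_def add.commute)
      moreover have "0 \<le> real P - real Q - 1" using assms by linarith
      ultimately show ?thesis by (intro mult_nonneg_nonneg) auto
    qed simp
    then show ?thesis unfolding R by (simp add: algebra_simps)
  qed
  \<comment> \<open>summand \<open>i\<close> is paired with its mirror image \<open>d - 1 - i\<close>\<close>
  have pairs: "c (Q + i) + c (Q + (d - Suc i)) \<le> c (P - 1) + c Q" if "i < d" for i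
  proof -
    have "(Q + i choose m') + (Q + (d - Suc i) choose m') \<le> (Q + (d - Suc i) + i choose m') + (Q choose m')"
      by (rule choose_convex) simp
    moreover have "Q + (d - Suc i) + i = P - 1" using that P by simp
    ultimately show ?thesis unfolding c_def by (metis of_nat_add of_nat_mono)
  qed
  have diff: "real (P choose m) - real (Q choose m) = (\<Sum>i<d. c (Q + i))"
    unfolding P m c_def by (rule choose_diff_telescope)
  have "2 * (real (P choose m) - real (Q choose m)) = (\<Sum>i<d. c (Q + i)) + (\<Sum>i<d. c (Q + (d - Suc i)))"
    unfolding diff using sum.nat_diff_reindex[of "\<lambda>i. c (Q + i)" d] by simp
  also have "\<dots> = (\<Sum>i<d. c (Q + i) + c (Q + (d - Suc i)))" by (simp add: sum.distrib)
  also have "\<dots> \<le> (\<Sum>i<d. c (P - 1) + c Q)" by (intro sum_mono pairs) simp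
  also have "\<dots> = real d * (c (P - 1) + c Q)" by simp
  finally have "(real P - real m) * (real Q + 1) * (2 * (real (P choose m) - real (Q choose m)))
      \<le> (real P - real m) * (real Q + 1) * (real d * (c (P - 1) + c Q))"
    using assms by (intro mult_left_mono) auto
  also have "\<dots> = real d * ((real P - real m) * (real Q + 1) * (c (P - 1) + c Q))" by simp
  also have "\<dots> \<le> real d * R" using ends by (intro mult_left_mono) auto
  finally show ?thesis unfolding R_def P by (simp add: algebra_simps)
qed

text \<open>
  One or two summands are their own trapezoidal approximation, so the threshold for a single step
  is exact.
\<close>

lemma choose_diff_trapezoid_eq:
  assumes "1 \<le> m" "m < P" "Q < P" "P \<le> Q + 2"
  shows "2 * (real P - real m) * (real Q + 1) * (real (P choose m) - real (Q choose m))
     = real m * real (Suc m) * (real P - real Q) * (real (P choose Suc m) + real (Suc Q choose Suc m))"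
proof -
  obtain m' where m: "m = Suc m'" using assms by (cases m) auto
  define c where "c j = real (j choose m')" for j
  have R: "real m * real (Suc m) * (real (P choose Suc m) + real (Suc Q choose Suc m))
      = real P * (real P - real m) * c (P - 1) + (real Q + 1) * (real Q + 1 - real m) * c Q"
    unfolding distrib_left choose_absorb_twice[OF assms(1)] by (simp add: c_def m)
  consider "P = Q + 1" | "P = Q + 2" using assms by linarith
  then show ?thesis
  proof cases
    case 1
    have D: "real (P choose m) - real (Q choose m) = c Q" by (simp add: 1 m c_def)
    show ?thesis unfolding D using R by (simp add: 1 algebra_simps)
  next
    case 2
    have D: "real (P choose m) - real (Q choose m) = c (P - 1) + c Q" by (simp add: 2 m c_def)
    have *: "(real Q + 1) * c Q = (real P - real m) * c (P - 1)"
      using pred_times_choose[OF assms(1,2)] by (simp add: c_def m 2 algebra_simps)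
    have PQ: "real P = real Q + 2" by (simp add: 2)
    have "real m * real (Suc m) * (real P - real Q) * (real (P choose Suc m) + real (Suc Q choose Suc m))
      = 2 * (real P * (real P - real m) * c (P - 1) + (real Q + 1 - real m) * ((real Q + 1) * c Q))"
      using arg_cong[OF R, of "\<lambda>x. 2 * x"] by (simp add: PQ algebra_simps)
    also have "\<dots> = 2 * (real P - real m) * (real Q + 1) * (c (P - 1)) +
        2 * (real P - real m) * ((real P - real m) * c (P - 1))"
      unfolding * PQ by (simp only: algebra_simps)
    also have "\<dots> = 2 * (real P - real m) * (real Q + 1) * (c (P - 1) + c Q)"
      unfolding *[symmetric] by (simp only: algebra_simps)
    finally show ?thesis unfolding D ..
  qed
qed

text \<open>
  After division by common binomial factors, moving a vertex changes \<open>pair_choices\<close> by an expression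
  in which the sizes \<open>s\<close> and \<open>s + k\<close> enter only through \<open>s\<close> and binomials of order \<open>k\<close> and \<open>m\<close>. This
  rests on \<open>(n choose s + k) (s + k choose s) = (n choose s) (n - s choose k)\<close>.
\<close>

lemma pair_choices_shift:
  assumes k: "k = Suc m"
  obtains C where "0 < C"
    "C * (real (pair_choices s (s + k) (P + s) (Suc (Q + s)))
          - real (pair_choices s (s + k) (Suc (P + s)) (Q + s)))
     = real s * (real P - real Q) * (real (P choose k) + real (Suc Q choose k))
       - (real P + 1 + real s) * (real Q + 1) * (real (P choose m) - real (Q choose m))"
proof -
  have pc: "real (s + k choose s) * real (pair_choices s (s + k) (A + s) (B + s)) =
      real (A + s choose s) * real (B + s choose s) * (real (A choose k) + real (B choose k))" for A B
  proof -
    have *: "(A + s choose (s + k)) * (s + k choose s) = (A + s choose s) * (A choose k)" for A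
    proof (cases "k \<le> A")
      case True then show ?thesis using choose_mult[of s "s + k" "A + s"] by simp
    qed (simp add: binomial_eq_0)
    have "(s + k choose s) * pair_choices s (s + k) (A + s) (B + s) =
        (A + s choose s) * ((B + s choose (s + k)) * (s + k choose s)) +
        (A + s choose (s + k)) * (s + k choose s) * (B + s choose s)"
      using assms by (simp add: pair_choices_def algebra_simps)
    also have "\<dots> = (A + s choose s) * (B + s choose s) * ((A choose k) + (B choose k))"
      unfolding * by (simp add: algebra_simps)
    finally show ?thesis by (metis of_nat_mult of_nat_add)
  qed
  define X where "X = real (P + s choose s) * real (Q + s choose s)"
  have X: "X > 0" by (simp add: X_def)
  define C where "C = real (s + k choose s)"
  have C: "C > 0" by (simp add: C_def)
  have up: "(real A + 1) * real (Suc (A + s) choose s) = (real A + 1 + real s) * real (A + s choose s)" for A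
  proof -
    have "(Suc (A + s) - s) * (Suc (A + s) choose s) = Suc (A + s) * (A + s choose s)"
      using binomial_absorb_comp[of "Suc (A + s)" s] by simp
    moreover have "Suc (A + s) - s = Suc A" by simp
    ultimately have "real (Suc A) * real (Suc (A + s) choose s) = real (Suc (A + s)) * real (A + s choose s)"
      by (metis of_nat_mult)
    then show ?thesis by (simp add: algebra_simps)
  qed
  let ?L = "real (pair_choices s (s + k) (Suc (P + s)) (Q + s))"
  let ?N = "real (pair_choices s (s + k) (P + s) (Suc (Q + s)))"
  let ?S = "real (P choose k) + real (Suc Q choose k)"
  let ?D = "real (P choose m) - real (Q choose m)"
  have L: "(real P + 1) * (C * ?L) = X * (real P + 1 + real s) * (?S + ?D)"
  proof -
    have "(real P + 1) * (C * ?L) = ((real P + 1) * real (Suc (P + s) choose s)) * real (Q + s choose s)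
        * (real (Suc P choose k) + real (Q choose k))"
      using pc[of "Suc P" Q] unfolding C_def by simp
    also have "\<dots> = X * (real P + 1 + real s) * (real (Suc P choose k) + real (Q choose k))"
      unfolding up X_def by (simp add: algebra_simps)
    also have "real (Suc P choose k) + real (Q choose k) = ?S + ?D" by (simp add: k)
    finally show ?thesis .
  qed
  have N: "(real Q + 1) * (C * ?N) = X * (real Q + 1 + real s) * ?S"
  proof -
    have "(real Q + 1) * (C * ?N) = real (P + s choose s) * ((real Q + 1) * real (Suc (Q + s) choose s)) * ?S"
      using pc[of P "Suc Q"] unfolding C_def by simp
    also have "\<dots> = X * (real Q + 1 + real s) * ?S"
      unfolding up X_def by (simp add: algebra_simps)
    finally show ?thesis .
  qed
  let ?pq = "(real P + 1) * (real Q + 1)"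
  have pq: "?pq * C > 0" using C by simp
  have 1: "?pq * C * ?L = X * ((real Q + 1) * (real P + 1 + real s) * (?S + ?D))"
    using arg_cong[OF L, of "\<lambda>x. (real Q + 1) * x"] by (simp only: mult_ac)
  have 2: "?pq * C * ?N = X * ((real P + 1) * (real Q + 1 + real s) * ?S)"
    using arg_cong[OF N, of "\<lambda>x. (real P + 1) * x"] by (simp only: mult_ac)
  have 3: "(real P + 1) * (real Q + 1 + real s) * ?S - (real Q + 1) * (real P + 1 + real s) * (?S + ?D)
      = real s * (real P - real Q) * ?S - (real P + 1 + real s) * (real Q + 1) * ?D"
    by (simp only: algebra_simps)
  have "?pq * C * (?N - ?L) = X * (real s * (real P - real Q) * ?S
      - (real P + 1 + real s) * (real Q + 1) * ?D)"
    unfolding right_diff_distrib[of "?pq * C"] 1 2 3[symmetric] by (simp only: right_diff_distrib)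
  then have "?pq * C / X * (?N - ?L) = real s * (real P - real Q) * ?S
      - (real P + 1 + real s) * (real Q + 1) * ?D"
    using X by (simp add: field_simps)
  moreover have "0 < ?pq * C / X" using pq X by simp
  ultimately show ?thesis using that by blast
qed

text \<open>
  By the trapezoidal bound it suffices that \<open>m k (P + 1 + s) < 2 s (P - m)\<close>. As \<open>m k + 1 \<le> 2 s\<close>, this
  holds as soon as \<open>P > m k (1 + s) + 2 s m\<close>; the additional \<open>k\<close> makes \<open>(P choose k)\<close> positive.
\<close>

lemma pair_choices_balance_wide:
  assumes k: "k = Suc m" and "1 \<le> m" "m * k < 2 * s" "Q < P"
    and large: "m * k * (1 + s) + 2 * s * m + k < P"
  shows "pair_choices s (s + k) (Suc (P + s)) (Q + s) < pair_choices s (s + k) (P + s) (Suc (Q + s))"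
proof -
  define S where "S = real (P choose k) + real (Suc Q choose k)"
  define L where "L = (real P + 1 + real s) * (real Q + 1) * (real (P choose m) - real (Q choose m))"
  have mP: "m < P" "k \<le> P" using large k by auto
  have S: "0 < S" using mP by (simp add: S_def add_pos_nonneg)
  have "2 * (real P - real m) * L
    = (real P + 1 + real s) * (2 * (real P - real m) * (real Q + 1) * (real (P choose m) - real (Q choose m)))"
    by (simp only: L_def mult_ac)
  also have "\<dots> \<le> (real P + 1 + real s) * (real m * real k * (real P - real Q) * S)"
    unfolding S_def k using choose_diff_trapezoid[OF \<open>1 \<le> m\<close> mP(1) \<open>Q < P\<close>] by (intro mult_left_mono) auto
  also have "\<dots> = (real (m * k) * (real P + 1 + real s)) * ((real P - real Q) * S)"
    by simp
  also have "\<dots> < (2 * (real P - real m) * real s) * ((real P - real Q) * S)"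
  proof (intro mult_strict_right_mono mult_pos_pos)
    have "m * k * (P + 1 + s) + 2 * s * m < m * k * P + P"
      using large by (simp add: algebra_simps)
    also have "\<dots> = (m * k + 1) * P" by (simp add: algebra_simps)
    also have "\<dots> \<le> 2 * s * P" using assms(3) by (intro mult_right_mono) auto
    finally have "real (m * k * (P + 1 + s) + 2 * s * m) < real (2 * s * P)" by (rule of_nat_less_iff[THEN iffD2])
    then show "real (m * k) * (real P + 1 + real s) < 2 * (real P - real m) * real s"
      by (simp add: algebra_simps)
  qed (use S \<open>Q < P\<close> in auto)
  finally have "2 * (real P - real m) * L < 2 * (real P - real m) * (real s * (real P - real Q) * S)"
    by (simp only: mult_ac)
  then have "L < real s * (real P - real Q) * S"
    by (rule mult_less_cancel_left_pos[THEN iffD1, rotated]) (use mP in simp)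
  moreover obtain C where "0 < C"
    "C * (real (pair_choices s (s + k) (P + s) (Suc (Q + s)))
          - real (pair_choices s (s + k) (Suc (P + s)) (Q + s)))
     = real s * (real P - real Q) * S - L"
    using pair_choices_shift[OF k, of s P Q] unfolding S_def L_def by metis
  ultimately have "0 < C * (real (pair_choices s (s + k) (P + s) (Suc (Q + s)))
          - real (pair_choices s (s + k) (Suc (P + s)) (Q + s)))" by linarith
  with \<open>0 < C\<close> show ?thesis by (simp add: zero_less_mult_iff)
qed

text \<open>
  Here the trapezoidal bound is attained, and the comparison \<open>m k (P + 1 + s) > 2 s (P - m)\<close> holds
  already when \<open>m k = 2 s\<close>: the borderline case belongs to the unbalanced side.
\<close>

lemma pair_choices_unbalance_wide:
  assumes k: "k = Suc m" and "1 \<le> m" "2 * s \<le> m * k" "Q < P" "P \<le> Q + 2" "k \<le> P"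
  shows "pair_choices s (s + k) (P + s) (Suc (Q + s)) < pair_choices s (s + k) (Suc (P + s)) (Q + s)"
proof -
  define S where "S = real (P choose k) + real (Suc Q choose k)"
  define L where "L = (real P + 1 + real s) * (real Q + 1) * (real (P choose m) - real (Q choose m))"
  have mP: "m < P" using assms by simp
  have S: "0 < S" using assms by (simp add: S_def add_pos_nonneg)
  have "2 * (real P - real m) * (real s * (real P - real Q) * S)
    = (2 * real s * (real P - real m)) * ((real P - real Q) * S)" by simp
  also have "\<dots> < (real (m * k) * (real P + 1 + real s)) * ((real P - real Q) * S)"
  proof (intro mult_strict_right_mono mult_pos_pos)
    have "2 * real s * (real P - real m) \<le> real (m * k) * (real P - real m)"
    proof (rule mult_right_mono)
      show "2 * real s \<le> real (m * k)" using of_nat_mono[OF assms(3), where 'a = real] by simp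
    qed (use mP in simp)
    also have "\<dots> < real (m * k) * (real P + 1 + real s)"
      using assms(1,2) by (intro mult_strict_left_mono) (auto simp: add_pos_nonneg)
    finally show "2 * real s * (real P - real m) < real (m * k) * (real P + 1 + real s)" .
  qed (use S \<open>Q < P\<close> in auto)
  also have "\<dots> = (real P + 1 + real s) * (real m * real k * (real P - real Q) * S)"
    by simp
  also have "\<dots> = (real P + 1 + real s) *
      (2 * (real P - real m) * (real Q + 1) * (real (P choose m) - real (Q choose m)))"
    unfolding S_def k choose_diff_trapezoid_eq[OF \<open>1 \<le> m\<close> mP \<open>Q < P\<close> \<open>P \<le> Q + 2\<close>] ..
  also have "\<dots> = 2 * (real P - real m) * L"
    by (simp only: L_def mult_ac)
  finally have "real s * (real P - real Q) * S < L"
    by (rule mult_less_cancel_left_pos[THEN iffD1, rotated]) (use mP in simp)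
  moreover obtain C where "0 < C"
    "C * (real (pair_choices s (s + k) (P + s) (Suc (Q + s)))
          - real (pair_choices s (s + k) (Suc (P + s)) (Q + s)))
     = real s * (real P - real Q) * S - L"
    using pair_choices_shift[OF k, of s P Q] unfolding S_def L_def by metis
  ultimately have "C * (real (pair_choices s (s + k) (P + s) (Suc (Q + s)))
          - real (pair_choices s (s + k) (Suc (P + s)) (Q + s))) < 0" by linarith
  with \<open>0 < C\<close> show ?thesis by (simp add: mult_less_0_iff)
qed

text \<open>
  With \<open>t = s + m + 1\<close> the inequality reads \<open>(m + 1/2)\<^sup>2 < 2 s + 1/4\<close>, that is
  \<open>m (m + 1) < 2 s\<close>.
\<close>

lemma sqrt_condition_iff:
  assumes "s \<le> t"
  shows "real t < real s + 1 / 2 + sqrt (2 * real s + 1 / 4) \<longleftrightarrow> t = s \<or> (t - s - 1) * (t - s) < 2 * s"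
proof (cases "t = s")
  case True
  then show ?thesis by (simp add: add_pos_pos add_nonneg_pos)
next
  case False
  with assms obtain m where t: "t = s + Suc m" by (metis less_iff_Suc_add le_neq_implies_less add_Suc_right)
  have "real t < real s + 1 / 2 + sqrt (2 * real s + 1 / 4) \<longleftrightarrow> real m + 1 / 2 < sqrt (2 * real s + 1 / 4)"
    unfolding t by (simp del: real_sqrt_less_iff) linarith
  also have "\<dots> \<longleftrightarrow> (real m + 1 / 2)\<^sup>2 < 2 * real s + 1 / 4"
    using real_sqrt_less_iff[of "(real m + 1 / 2)\<^sup>2" "2 * real s + 1 / 4"] by simp
  also have "\<dots> \<longleftrightarrow> real (m * Suc m) < real (2 * s)" by (simp add: power2_eq_square algebra_simps)
  also have "\<dots> \<longleftrightarrow> m * Suc m < 2 * s" by (rule of_nat_less_iff)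
  finally show ?thesis by (simp add: t)
qed

section \<open>Copies as families of completely joined parts\<close>

definition is_graph :: "'v set \<Rightarrow> ('v \<times> 'v) set \<Rightarrow> bool" where
  "is_graph V E \<longleftrightarrow> finite V \<and> E \<subseteq> V \<times> V \<and> sym E \<and> irrefl E"

definition no_clique :: "nat \<Rightarrow> 'v set \<Rightarrow> ('v \<times> 'v) set \<Rightarrow> bool" where
  "no_clique k V E \<longleftrightarrow> \<not> (\<exists>S\<subseteq>V. card S = k \<and> (\<forall>x\<in>S. \<forall>y\<in>S. x \<noteq> y \<longrightarrow> (x, y) \<in> E))"

definition join_edges :: "'v set set \<Rightarrow> ('v \<times> 'v) set" where
  "join_edges P = {(u, v). \<exists>A\<in>P. \<exists>B\<in>P. A \<noteq> B \<and> u \<in> A \<and> v \<in> B}"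

text \<open>
  Only finite families matter: \<open>mset_set\<close> sends infinite ones to the empty multiset.
\<close>

definition shape :: "'v set set \<Rightarrow> nat multiset" where
  "shape P = image_mset card (mset_set P)"

text \<open>
  A complete multipartite graph with nonempty parts and the partition of its vertices into parts
  determine each other, so the copies of such a graph are counted by partitions. Over an irreflexive
  \<open>E\<close> the members of a family are disjoint automatically.
\<close>

definition part_copies :: "nat multiset \<Rightarrow> 'v set \<Rightarrow> ('v \<times> 'v) set \<Rightarrow> 'v set set set" where
  "part_copies M V E =
     {P. \<Union>P \<subseteq> V \<and> shape P = M \<and> (\<forall>A\<in>P. \<forall>B\<in>P. A \<noteq> B \<longrightarrow> A \<times> B \<subseteq> E)}"

lemma pair_graph_iff: "pair_graph G \<longleftrightarrow> is_graph (pverts G) (parcs G)"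
proof
  assume "pair_graph G"
  then interpret pair_graph G .
  show "is_graph (pverts G) (parcs G)"
    unfolding is_graph_def irrefl_def
    using pair_finite_verts in_arcsD1 in_arcsD2 arcs_symmetric
    by (auto intro: symI dest: no_loops')
next
  assume "is_graph (pverts G) (parcs G)"
  then have *: "finite (pverts G)" "parcs G \<subseteq> pverts G \<times> pverts G" "sym (parcs G)" "irrefl (parcs G)"
    by (auto simp: is_graph_def)
  moreover have "finite (parcs G)" by (rule finite_subset[OF *(2)]) (use *(1) in simp)
  ultimately show "pair_graph G"
    by unfold_locales (auto simp: symmetric_def irrefl_def)
qed

lemma clique_free_iff:
  assumes "pair_graph G"
  shows "clique_free k G \<longleftrightarrow> no_clique k (pverts G) (parcs G)"
proof -
  interpret pair_graph G by fact
  have "(\<exists>H. subgraph (with_proj H) (with_proj G) \<and> complete_digraph k (with_proj H)) \<longleftrightarrow>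
    (\<exists>S\<subseteq>pverts G. card S = k \<and> (\<forall>x\<in>S. \<forall>y\<in>S. x \<noteq> y \<longrightarrow> (x, y) \<in> parcs G))" (is "?L \<longleftrightarrow> ?R")
  proof
    assume ?L
    then obtain H where H: "subgraph (with_proj H) (with_proj G)" "complete_digraph k (with_proj H)" by blast
    have "pverts H \<subseteq> pverts G" "parcs H \<subseteq> parcs G"
      using H(1) by (auto simp: subgraph_def)
    moreover have "card (pverts H) = k" "parcs H = {(u, v). (u, v) \<in> pverts H \<times> pverts H \<and> u \<noteq> v}"
      using H(2) unfolding complete_digraph_pair_def by auto
    ultimately show ?R by (intro exI[of _ "pverts H"]) auto
  next
    assume ?R
    then obtain S where S: "S \<subseteq> pverts G" "card S = k" "\<forall>x\<in>S. \<forall>y\<in>S. x \<noteq> y \<longrightarrow> (x, y) \<in> parcs G" by blast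
    define H where "H = \<lparr>pverts = S, parcs = {(u, v). (u, v) \<in> S \<times> S \<and> u \<noteq> v}\<rparr>"
    have "finite S" using S(1) pair_finite_verts finite_subset by blast
    then have K: "complete_digraph k (with_proj H)"
      unfolding complete_digraph_pair_def using S(2) by (simp add: H_def)
    then interpret H: pair_graph H by (rule pair_graphI_complete)
    have "subgraph (with_proj H) (with_proj G)"
      unfolding subgraph_def using S H.wf_digraph wf_digraph by (auto simp: H_def)
    with K show ?L by blast
  qed
  then show ?thesis by (simp add: clique_free_def no_clique_def)
qed

lemma digraph_iso_iff:
  assumes "pair_graph G"
  shows "digraph_iso (with_proj G) (with_proj H) \<longleftrightarrow>
    (\<exists>f. inj_on f (pverts G) \<and> pverts H = f ` pverts G \<and> parcs H = map_prod f f ` parcs G)"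
    (is "?L \<longleftrightarrow> ?R")
proof -
  interpret pair_graph G by fact
  show ?thesis
  proof
    assume ?L
    then obtain h where h: "pre_digraph.digraph_isomorphism (with_proj G) h"
      and H: "with_proj H = app_iso h (with_proj G)"
      unfolding digraph_iso_def by blast
    define f where "f = iso_verts h"
    have tails: "iso_tail h = fst" "iso_head h = snd"
      using arg_cong[OF H, of tail] arg_cong[OF H, of head] by simp_all
    have verts: "pverts H = f ` pverts G" and arcs: "parcs H = iso_arcs h ` parcs G"
      using arg_cong[OF H, of verts] arg_cong[OF H, of arcs] by (simp_all add: f_def)
    have "iso_arcs h a = map_prod f f a" if "a \<in> parcs G" for a
    proof (rule prod_eqI)
      show "fst (iso_arcs h a) = fst (map_prod f f a)" "snd (iso_arcs h a) = snd (map_prod f f a)"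
        using h that unfolding pre_digraph.digraph_isomorphism_def f_def
        by (auto simp: tails split: prod.splits)
    qed
    then have "parcs H = map_prod f f ` parcs G" unfolding arcs by (intro image_cong) auto
    moreover have "inj_on f (pverts G)"
      using h by (simp add: pre_digraph.digraph_isomorphism_def f_def)
    ultimately show ?R using verts by blast
  next
    assume ?R
    then obtain f where f: "inj_on f (pverts G)" "pverts H = f ` pverts G" "parcs H = map_prod f f ` parcs G"
      by blast
    define h where "h = \<lparr>iso_verts = f, iso_arcs = map_prod f f, iso_head = snd, iso_tail = fst\<rparr>"
    have "inj_on (map_prod f f) (parcs G)"
      using f(1) in_arcsD1 in_arcsD2 by (auto simp: inj_on_def)
    then have "pre_digraph.digraph_isomorphism (with_proj G) h"
      unfolding pre_digraph.digraph_isomorphism_def using f wf_digraph by (simp add: h_def)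
    moreover have "with_proj H = app_iso h (with_proj G)"
      unfolding with_proj_def app_iso_def by (simp add: h_def f)
    ultimately show ?L unfolding digraph_iso_def by blast
  qed
qed

lemma ex_bij_betw_image_mset_eq:
  assumes "finite A" "finite B" "image_mset f (mset_set A) = image_mset g (mset_set B)"
  shows "\<exists>h. bij_betw h A B \<and> (\<forall>x\<in>A. g (h x) = f x)"
  using assms
proof (induction A arbitrary: B rule: finite_induct)
  case empty
  then show ?case by (auto simp: mset_set_empty_iff bij_betw_def)
next
  case (insert a A)
  have "f a \<in># image_mset g (mset_set B)"
    using insert by (metis image_eqI image_mset_add_mset mset_set.insert union_single_eq_member)
  then obtain b where b: "b \<in> B" "g b = f a" using insert.prems by auto
  have "image_mset f (mset_set A) = image_mset g (mset_set (B - {b}))"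
    using insert b by (simp add: mset_set_Diff image_mset_Diff flip: mset_set.remove)
      (metis add_mset_remove_trivial image_mset_add_mset insert.prems(2) mset_set.remove)
  then obtain h where h: "bij_betw h A (B - {b})" "\<forall>x\<in>A. g (h x) = f x"
    using insert by (metis finite_Diff)
  have "bij_betw (h(a := b)) (insert a A) (insert b (B - {b}))"
    using h(1) insert.hyps
    by (auto simp: bij_betw_def inj_on_def)
  then show ?case using h(2) b insert.hyps
    by (intro exI[of _ "h(a := b)"]) (auto simp: insert_absorb fun_upd_def)
qed

lemma join_edges_image:
  assumes "inj_on f (\<Union>P)"
  shows "join_edges ((`) f ` P) = map_prod f f ` join_edges P"
proof -
  have ne: "f ` A \<noteq> f ` B" if "A \<in> P" "B \<in> P" "A \<noteq> B" for A B
    using that inj_on_image_eq_iff[OF assms, of A B] by blast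
  show ?thesis
  proof (intro equalityI subsetI)
    fix e assume "e \<in> join_edges ((`) f ` P)"
    then obtain A B u v where *: "A \<in> P" "B \<in> P" "f ` A \<noteq> f ` B" "u \<in> A" "v \<in> B" "e = (f u, f v)"
      unfolding join_edges_def by blast
    then have "(u, v) \<in> join_edges P" unfolding join_edges_def by blast
    then show "e \<in> map_prod f f ` join_edges P" using * by force
  next
    fix e assume "e \<in> map_prod f f ` join_edges P"
    then obtain u v A B where *: "A \<in> P" "B \<in> P" "A \<noteq> B" "u \<in> A" "v \<in> B" "e = (f u, f v)"
      by (auto simp: join_edges_def)
    then have "f ` A \<in> (`) f ` P" "f ` B \<in> (`) f ` P" "f u \<in> f ` A" "f v \<in> f ` B" by auto
    with ne[OF *(1-3)] show "e \<in> join_edges ((`) f ` P)"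
      unfolding join_edges_def *(6) mem_Collect_eq case_prod_conv
      by (intro bexI[of _ "f ` A"] bexI[of _ "f ` B"] conjI)
  qed
qed

lemma shape_image:
  assumes "inj_on f (\<Union>P)"
  shows "shape ((`) f ` P) = shape P"
proof -
  have "inj_on ((`) f) P"
    using inj_on_image_eq_iff[OF assms] by (auto simp: inj_on_def)
  then have "shape ((`) f ` P) = image_mset (card \<circ> (`) f) (mset_set P)"
    unfolding shape_def by (simp add: multiset.map_comp flip: image_mset_mset_set)
  also have "\<dots> = shape P"
    unfolding shape_def
  proof (rule image_mset_cong)
    fix A assume "A \<in># mset_set P"
    then have "A \<in> P" by (cases "finite P") auto
    then have "inj_on f A" using inj_on_subset[OF assms] by blast
    then show "(card \<circ> (`) f) A = card A" by (simp add: card_image)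
  qed
  finally show ?thesis .
qed

text \<open>
  Complete multipartite graphs with the same part sizes are isomorphic: match parts of equal size
  and glue bijections between them.
\<close>

lemma same_shape_bij:
  assumes "finite P" "finite Q" "disjoint P" "disjoint Q" "\<And>A. A \<in> P \<Longrightarrow> finite A"
    and "\<And>B. B \<in> Q \<Longrightarrow> finite B" and "shape P = shape Q"
  obtains f where "inj_on f (\<Union>P)" "Q = (`) f ` P"
proof -
  obtain h where h: "bij_betw h P Q" "\<forall>A\<in>P. card (h A) = card A"
    using ex_bij_betw_image_mset_eq[OF assms(1,2), of card card] assms(7) unfolding shape_def by blast
  have "\<exists>g. bij_betw g A (h A)" if "A \<in> P" for A
    using that h assms(5,6) by (intro finite_same_card_bij) (auto dest: bij_betwE)
  then obtain g where g: "\<And>A. A \<in> P \<Longrightarrow> bij_betw (g A) A (h A)" by metis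
  define f where "f x = g (THE A. A \<in> P \<and> x \<in> A) x" for x
  have f: "f x = g A x" if "A \<in> P" "x \<in> A" for A x
  proof -
    have "(THE A. A \<in> P \<and> x \<in> A) = A"
      using that assms(3) by (intro the_equality) (auto simp: disjoint_def)
    then show ?thesis by (simp add: f_def)
  qed
  have im: "f ` A = h A" if "A \<in> P" for A
    using bij_betw_imp_surj_on[OF g[OF that]] f[OF that] by (metis image_cong)
  have "inj_on f (\<Union>P)"
  proof (rule inj_onI)
    fix x y assume "x \<in> \<Union>P" "y \<in> \<Union>P" and eq: "f x = f y"
    then obtain A B where AB: "A \<in> P" "x \<in> A" "B \<in> P" "y \<in> B" by blast
    have "f x \<in> h A" "f x \<in> h B" using im AB eq by (metis image_eqI)+
    moreover have "h A \<in> Q" "h B \<in> Q" using h(1) AB by (auto dest: bij_betwE)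
    ultimately have "h A = h B" using assms(4) by (auto simp: disjoint_def)
    then have "A = B" using h(1) AB by (auto simp: bij_betw_def inj_on_def)
    with AB eq f have "g A x = g A y" by metis
    then show "x = y" using g[OF AB(1)] AB \<open>A = B\<close> by (auto simp: bij_betw_def inj_on_def)
  qed
  moreover have "Q = (`) f ` P"
    using bij_betw_imp_surj_on[OF h(1)] im by (metis image_cong)
  ultimately show ?thesis using that by blast
qed

lemma part_copiesD:
  assumes "is_graph V E" "P \<in> part_copies M V E" "0 \<notin># M"
  shows "finite P" "\<And>A. A \<in> P \<Longrightarrow> finite A" "{} \<notin> P" "disjoint P"
proof -
  have V: "finite V" "irrefl E" using assms(1) by (auto simp: is_graph_def)
  have P: "\<Union>P \<subseteq> V" "shape P = M" "\<forall>A\<in>P. \<forall>B\<in>P. A \<noteq> B \<longrightarrow> A \<times> B \<subseteq> E"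
    using assms(2) by (auto simp: part_copies_def)
  show fin: "finite P" using P(1) V(1) by (meson finite_UnionD finite_subset)
  show "finite A" if "A \<in> P" for A using that P(1) V(1) by (meson Union_upper finite_subset)
  show "{} \<notin> P"
  proof
    assume "{} \<in> P"
    then have "0 \<in> card ` P" by (rule image_eqI[rotated]) simp
    then have "0 \<in># shape P" unfolding shape_def using fin by simp
    then show False using assms(3) P(2) by simp
  qed
  show "disjoint P" using P(3) V(2) by (auto simp: disjoint_def irrefl_def)
qed

lemma finite_part_copies: "finite V \<Longrightarrow> finite (part_copies M V E)"
  by (rule finite_subset[of _ "Pow (Pow V)"]) (unfold part_copies_def, blast, simp)

text \<open>
  The parts are the classes of non-adjacency, which is why different families give different
  subgraphs.
\<close>

lemma join_edges_recover_parts: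
  assumes "disjoint P" "{} \<notin> P"
  shows "P = (\<lambda>u. {v \<in> \<Union>P. (u, v) \<notin> join_edges P}) ` \<Union>P"
proof -
  have *: "{v \<in> \<Union>P. (u, v) \<notin> join_edges P} = A" if "A \<in> P" "u \<in> A" for A u
  proof (intro equalityI subsetI)
    fix v assume "v \<in> {v \<in> \<Union>P. (u, v) \<notin> join_edges P}"
    then obtain B where "B \<in> P" "v \<in> B" "(u, v) \<notin> join_edges P" by blast
    then show "v \<in> A" using that by (cases "A = B") (auto simp: join_edges_def)
  next
    fix v assume v: "v \<in> A"
    have "C = A" if "C \<in> P" "x \<in> C" "x \<in> A" for C x
      using assms(1) \<open>A \<in> P\<close> that by (auto simp: disjoint_def)
    then have "(u, v) \<notin> join_edges P" using that v by (auto simp: join_edges_def)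
    then show "v \<in> {v \<in> \<Union>P. (u, v) \<notin> join_edges P}" using v that by blast
  qed
  show ?thesis
  proof (intro equalityI subsetI)
    fix A assume A: "A \<in> P"
    then obtain u where "u \<in> A" using assms(2) by (metis all_not_in_conv)
    then show "A \<in> (\<lambda>u. {v \<in> \<Union>P. (u, v) \<notin> join_edges P}) ` \<Union>P" using *[OF A] A by blast
  next
    fix A assume "A \<in> (\<lambda>u. {v \<in> \<Union>P. (u, v) \<notin> join_edges P}) ` \<Union>P"
    then obtain u B where "u \<in> B" "B \<in> P" "A = {v \<in> \<Union>P. (u, v) \<notin> join_edges P}" by blast
    then show "A \<in> P" using *[of B u] by simp
  qed
qed

lemma is_graph_join_edges:
  assumes "finite (\<Union>P)" "disjoint P"
  shows "is_graph (\<Union>P) (join_edges P)"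
proof -
  have "sym (join_edges P)" by (rule symI) (auto simp: join_edges_def)
  moreover have "irrefl (join_edges P)"
    using assms(2) by (auto simp: irrefl_def join_edges_def disjoint_def)
  moreover have "join_edges P \<subseteq> \<Union>P \<times> \<Union>P" by (auto simp: join_edges_def)
  ultimately show ?thesis using assms(1) by (simp add: is_graph_def)
qed

lemma shape_partition_on:
  assumes "partition_on A P" "finite A"
  shows "0 \<notin># shape P"
proof
  assume "0 \<in># shape P"
  then obtain B where B: "B \<in> P" "card B = 0"
    using finite_elements[OF assms(2,1)] by (auto simp: shape_def)
  have "finite B" using B(1) assms by (auto simp: partition_on_def intro: finite_subset)
  then show False using B partition_onD3[OF assms(1)] by auto
qed

text \<open>
  From here on, copies of \<open>T\<close> are treated as families of parts.
\<close>

lemma num_copies_eq_card_part_copies: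
  fixes T :: "'a pair_pre_digraph" and G :: "'b pair_pre_digraph"
  assumes T: "pair_graph T" and PT: "partition_on (pverts T) PT" "parcs T = join_edges PT"
    and G: "pair_graph G"
  shows "num_copies T G = card (part_copies (shape PT) (pverts G) (parcs G))"
proof -
  interpret G: pair_graph G by fact
  let ?mk = "\<lambda>P :: 'b set set. \<lparr>pverts = \<Union>P, parcs = join_edges P\<rparr>"
  let ?C = "part_copies (shape PT) (pverts G) (parcs G)"
  have finT: "finite (pverts T)" using T by (simp add: pair_graph_iff is_graph_def)
  have gG: "is_graph (pverts G) (parcs G)" using G by (simp add: pair_graph_iff)
  have zero: "0 \<notin># shape PT" by (rule shape_partition_on[OF PT(1) finT])
  have finPT: "finite PT" by (rule finite_elements[OF finT PT(1)])
  have UPT: "\<Union>PT = pverts T" "disjoint PT" using PT(1) by (auto simp: partition_on_def)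
  note D = part_copiesD[OF gG _ zero]

  have inj: "inj_on ?mk ?C"
  proof (rule inj_onI)
    fix P Q assume PQ: "P \<in> ?C" "Q \<in> ?C" "?mk P = ?mk Q"
    have "P = (\<lambda>u. {v \<in> \<Union>P. (u, v) \<notin> join_edges P}) ` \<Union>P"
      by (rule join_edges_recover_parts[OF D(4,3)[OF PQ(1)]])
    also have "\<dots> = (\<lambda>u. {v \<in> \<Union>Q. (u, v) \<notin> join_edges Q}) ` \<Union>Q" using PQ(3) by simp
    also have "\<dots> = Q"
      by (rule join_edges_recover_parts[OF D(4,3)[OF PQ(2)], symmetric])
    finally show "P = Q" .
  qed
  have image: "?mk ` ?C = {H. subgraph (with_proj H) (with_proj G) \<and> digraph_iso (with_proj T) (with_proj H)}"
  proof (intro equalityI subsetI)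
    fix H assume "H \<in> ?mk ` ?C"
    then obtain P where P: "P \<in> ?C" and H: "H = ?mk P" by blast
    have sub: "\<Union>P \<subseteq> pverts G" "join_edges P \<subseteq> parcs G" and sh: "shape P = shape PT"
      using P unfolding part_copies_def join_edges_def by blast+
    obtain f where f: "inj_on f (\<Union>PT)" "P = (`) f ` PT"
      by (rule same_shape_bij[of PT P])
        (use finPT D[OF P] UPT sh finT in \<open>auto intro: finite_subset\<close>)
    have "digraph_iso (with_proj T) (with_proj H)"
      unfolding digraph_iso_iff[OF T] H using f(1) join_edges_image[OF f(1)]
      by (intro exI[of _ f]) (simp add: f(2) UPT PT(2) flip: UPT(1) image_Union)
    moreover have "subgraph (with_proj H) (with_proj G)"
    proof -
      have "pair_graph H" unfolding pair_graph_iff H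
        using is_graph_join_edges[OF _ D(4)[OF P]] finite_subset[OF sub(1)] G.pair_finite_verts by simp
      then interpret H: pair_graph H .
      show ?thesis unfolding subgraph_def using sub H.wf_digraph G.wf_digraph H by auto
    qed
    ultimately show "H \<in> {H. subgraph (with_proj H) (with_proj G) \<and> digraph_iso (with_proj T) (with_proj H)}"
      by blast
  next
    fix H assume "H \<in> {H. subgraph (with_proj H) (with_proj G) \<and> digraph_iso (with_proj T) (with_proj H)}"
    then obtain f where f: "inj_on f (pverts T)" "pverts H = f ` pverts T" "parcs H = map_prod f f ` parcs T"
      and sub: "pverts H \<subseteq> pverts G" "parcs H \<subseteq> parcs G"
      unfolding digraph_iso_iff[OF T] by (auto simp: subgraph_def)
    define P where "P = (`) f ` PT"
    have H: "parcs H = join_edges P" "pverts H = \<Union>P"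
      using f(2,3) join_edges_image[of f PT] f(1)
      by (simp_all add: P_def UPT PT(2) flip: image_Union)
    then have "H = ?mk P" by simp
    moreover have "P \<in> ?C"
    proof -
      have "shape P = shape PT"
        unfolding P_def by (rule shape_image) (simp add: UPT f)
      moreover have "A \<times> B \<subseteq> join_edges P" if "A \<in> P" "B \<in> P" "A \<noteq> B" for A B
        using that unfolding join_edges_def by blast
      ultimately show ?thesis using sub unfolding H part_copies_def by blast
    qed
    ultimately show "H \<in> ?mk ` ?C" by blast
  qed
  show ?thesis unfolding num_copies_def image[symmetric] by (rule card_image[OF inj])
qed

text \<open>
  Isomorphic graphs have the same number of copies; one inequality is enough below, because the
  graph on the left will be extremal.
\<close>

lemma card_part_copies_image:
  assumes "inj_on f V" "E \<subseteq> V \<times> V" "finite V"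
  shows "card (part_copies M V E) \<le> card (part_copies M (f ` V) (map_prod f f ` E))"
proof (rule card_inj_on_le)
  show "inj_on (\<lambda>P. (`) f ` P) (part_copies M V E)"
  proof (intro inj_on_image)
    show "inj_on f (\<Union>(\<Union>(part_copies M V E)))"
      by (rule inj_on_subset[OF assms(1)]) (auto simp: part_copies_def)
  qed
  show "(\<lambda>P. (`) f ` P) ` part_copies M V E \<subseteq> part_copies M (f ` V) (map_prod f f ` E)"
  proof
    fix Q assume "Q \<in> (\<lambda>P. (`) f ` P) ` part_copies M V E"
    then obtain P where P: "P \<in> part_copies M V E" "Q = (`) f ` P" by blast
    then have "\<Union>P \<subseteq> V" by (simp add: part_copies_def)
    then have "inj_on f (\<Union>P)" using assms(1) inj_on_subset by blast
    then have "shape Q = M" using P by (simp add: shape_image part_copies_def)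
    moreover have "A \<times> B \<subseteq> map_prod f f ` E" if "A \<in> Q" "B \<in> Q" "A \<noteq> B" for A B
    proof -
      obtain A' B' where AB: "A' \<in> P" "B' \<in> P" "A = f ` A'" "B = f ` B'" "A' \<noteq> B'"
        using \<open>A \<in> Q\<close> \<open>B \<in> Q\<close> \<open>A \<noteq> B\<close> P(2) by blast
      then have "A' \<times> B' \<subseteq> E" using P(1) by (simp add: part_copies_def)
      then show ?thesis unfolding AB by force
    qed
    moreover have "\<Union>Q \<subseteq> f ` V" using \<open>\<Union>P \<subseteq> V\<close> P(2) by blast
    ultimately show "Q \<in> part_copies M (f ` V) (map_prod f f ` E)" by (simp add: part_copies_def)
  qed
qed (use assms in \<open>simp add: finite_part_copies\<close>)

section \<open>Cloning a vertex\<close>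

text \<open>
  The graph is pulled back along the map that sends \<open>u\<close> to \<open>v\<close> and fixes everything else: \<open>u\<close> gets
  the neighbours of \<open>v\<close>, and \<open>u\<close> and \<open>v\<close> are non-adjacent because \<open>v\<close> has no loop.
\<close>

definition clone :: "'v set \<Rightarrow> ('v \<times> 'v) set \<Rightarrow> 'v \<Rightarrow> 'v \<Rightarrow> ('v \<times> 'v) set" where
  "clone V E u v = {(x, y). x \<in> V \<and> y \<in> V \<and> ((id(u := v)) x, (id(u := v)) y) \<in> E}"

definition extremal :: "nat multiset \<Rightarrow> nat \<Rightarrow> 'v set \<Rightarrow> ('v \<times> 'v) set \<Rightarrow> bool" where
  "extremal M k V E \<longleftrightarrow> is_graph V E \<and> no_clique k V E \<and>
     (\<forall>E'. is_graph V E' \<and> no_clique k V E' \<longrightarrow> card (part_copies M V E') \<le> card (part_copies M V E))"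

definition twin_pairs :: "'v set \<Rightarrow> ('v \<times> 'v) set \<Rightarrow> ('v \<times> 'v) set" where
  "twin_pairs V E = {(x, y). x \<in> V \<and> y \<in> V \<and> E `` {x} = E `` {y}}"

lemma is_graph_clone:
  assumes "is_graph V E"
  shows "is_graph V (clone V E u v)"
proof -
  have "sym E" "irrefl E" "finite V" using assms by (auto simp: is_graph_def)
  moreover have "sym (clone V E u v)"
    by (rule symI) (use \<open>sym E\<close> in \<open>auto simp only: clone_def mem_Collect_eq case_prod_conv dest: symD\<close>)
  moreover have "irrefl (clone V E u v)"
    using \<open>irrefl E\<close> by (simp only: irrefl_def clone_def mem_Collect_eq case_prod_conv) blast
  moreover have "clone V E u v \<subseteq> V \<times> V" by (auto simp only: clone_def)
  ultimately show ?thesis by (simp add: is_graph_def)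
qed

text \<open>
  The defining map is injective on cliques of the clone graph and sends them to cliques of \<open>E\<close>.
\<close>

lemma no_clique_clone:
  assumes E: "is_graph V E" "no_clique k V E" and uv: "v \<in> V"
  shows "no_clique k V (clone V E u v)"
  unfolding no_clique_def
proof
  assume "\<exists>S\<subseteq>V. card S = k \<and> (\<forall>x\<in>S. \<forall>y\<in>S. x \<noteq> y \<longrightarrow> (x, y) \<in> clone V E u v)"
  then obtain S where S: "S \<subseteq> V" "card S = k"
    and "\<And>x y. x \<in> S \<Longrightarrow> y \<in> S \<Longrightarrow> x \<noteq> y \<Longrightarrow> (x, y) \<in> clone V E u v" by blast
  then have adj: "((id(u := v)) x, (id(u := v)) y) \<in> E" if "x \<in> S" "y \<in> S" "x \<noteq> y" for x y
    using that unfolding clone_def by blast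
  have "irrefl E" using E by (simp add: is_graph_def)
  then have "inj_on (id(u := v)) S"
    using adj by (intro inj_onI) (metis irrefl_def)
  then have "card (id(u := v) ` S) = k" using S card_image by blast
  moreover have "id(u := v) ` S \<subseteq> V" using S uv by auto
  moreover have "\<forall>x\<in>id(u := v) ` S. \<forall>y\<in>id(u := v) ` S. x \<noteq> y \<longrightarrow> (x, y) \<in> E"
    using adj by blast
  ultimately show False using E(2) unfolding no_clique_def by blast
qed

text \<open>
  The three summands count copies in the clone graph that avoid \<open>u\<close>, that contain \<open>u\<close> but not \<open>v\<close>,
  and that contain both. Those of the second kind arise from copies containing only \<open>v\<close> by
  substituting \<open>u\<close>. Those of the third kind are old copies: \<open>u\<close> and \<open>v\<close> lie in one part, so the
  other parts are joined to \<open>v\<close>.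
\<close>

lemma part_copies_clone_lower_bound:
  assumes E: "is_graph V E" and uv: "u \<in> V" "v \<in> V" "u \<noteq> v" "(u, v) \<notin> E"
  shows "card {P \<in> part_copies M V E. u \<notin> \<Union>P} + card {P \<in> part_copies M V E. u \<notin> \<Union>P \<and> v \<in> \<Union>P}
    + card {P \<in> part_copies M V E. u \<in> \<Union>P \<and> v \<in> \<Union>P} \<le> card (part_copies M V (clone V E u v))"
proof -
  let ?C = "part_copies M V E" and ?C' = "part_copies M V (clone V E u v)"
  define S1 where "S1 = {P \<in> ?C. u \<notin> \<Union>P}"
  define S2 where "S2 = {P \<in> ?C. u \<notin> \<Union>P \<and> v \<in> \<Union>P}"
  define S3 where "S3 = {P \<in> ?C. u \<in> \<Union>P \<and> v \<in> \<Union>P}"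
  have finV: "finite V" and symE: "sym E" using E by (auto simp: is_graph_def)
  have D: "\<Union>P \<subseteq> V" "shape P = M" "\<And>A B x y. A \<in> P \<Longrightarrow> B \<in> P \<Longrightarrow> A \<noteq> B \<Longrightarrow> x \<in> A \<Longrightarrow> y \<in> B \<Longrightarrow> (x, y) \<in> E"
    if "P \<in> ?C" for P using that unfolding part_copies_def by blast+
  have I: "P \<in> ?C'" if "\<Union>P \<subseteq> V" "shape P = M"
    "\<And>A B x y. A \<in> P \<Longrightarrow> B \<in> P \<Longrightarrow> A \<noteq> B \<Longrightarrow> x \<in> A \<Longrightarrow> y \<in> B \<Longrightarrow> ((id(u := v)) x, (id(u := v)) y) \<in> E" for P
  proof -
    have "A \<times> B \<subseteq> clone V E u v" if "A \<in> P" "B \<in> P" "A \<noteq> B" for A B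
    proof clarify
      fix x y assume "x \<in> A" "y \<in> B"
      then show "(x, y) \<in> clone V E u v"
        using \<open>\<Union>P \<subseteq> V\<close> \<open>A \<in> P\<close> \<open>B \<in> P\<close> \<open>A \<noteq> B\<close> that(3)
          \<open>\<And>A B x y. A \<in> P \<Longrightarrow> B \<in> P \<Longrightarrow> A \<noteq> B \<Longrightarrow> x \<in> A \<Longrightarrow> y \<in> B \<Longrightarrow> ((id(u := v)) x, (id(u := v)) y) \<in> E\<close>
        unfolding clone_def by blast
    qed
    with that(1,2) show ?thesis unfolding part_copies_def by blast
  qed
  have S1: "S1 \<subseteq> ?C'"
  proof
    fix P assume "P \<in> S1"
    then have P: "P \<in> ?C" "u \<notin> \<Union>P" by (auto simp: S1_def)
    show "P \<in> ?C'"
    proof (rule I[OF D(1,2)[OF P(1)]])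
      fix A B x y assume AB: "A \<in> P" "B \<in> P" "A \<noteq> B" "x \<in> A" "y \<in> B"
      then have "x \<noteq> u" "y \<noteq> u" using P(2) by blast+
      then show "((id(u := v)) x, (id(u := v)) y) \<in> E" using D(3)[OF P(1) AB] by simp
    qed
  qed
  have S3: "S3 \<subseteq> ?C'"
  proof
    fix P assume "P \<in> S3"
    then have P: "P \<in> ?C" "u \<in> \<Union>P" "v \<in> \<Union>P" by (auto simp: S3_def)
    \<comment> \<open>\<open>u\<close> and \<open>v\<close> are non-adjacent, so they lie in the same part\<close>
    have same: "v \<in> A" if "A \<in> P" "u \<in> A" for A
      using D(3)[OF P(1)] that P(3) uv(4) by blast
    show "P \<in> ?C'"
    proof (rule I[OF D(1,2)[OF P(1)]])
      fix A B x y assume AB: "A \<in> P" "B \<in> P" "A \<noteq> B" "x \<in> A" "y \<in> B"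
      then have "(id(u := v)) x \<in> A" "(id(u := v)) y \<in> B" using same by auto
      then show "((id(u := v)) x, (id(u := v)) y) \<in> E" using D(3)[OF P(1) AB(1-3)] by blast
    qed
  qed
  define f where "f = id(v := u)"
  have inj_f: "inj_on f (V - {u})" by (auto simp: f_def inj_on_def)
  have S2: "(`) ((`) f) ` S2 \<subseteq> {P \<in> ?C'. u \<in> \<Union>P \<and> v \<notin> \<Union>P}"
  proof
    fix Q assume "Q \<in> (`) ((`) f) ` S2"
    then obtain P where P: "P \<in> ?C" "u \<notin> \<Union>P" "v \<in> \<Union>P" and Q: "Q = (`) f ` P" by (auto simp: S2_def)
    have UQ: "\<Union>Q = f ` \<Union>P" by (auto simp: Q)
    \<comment> \<open>substituting \<open>u\<close> for \<open>v\<close> is undone by the map that defines the clone graph\<close>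
    have fback: "(id(u := v)) (f x) = x" if "x \<in> \<Union>P" for x
      using that P(2) by (auto simp: f_def)
    have "Q \<in> ?C'"
    proof (rule I)
      show "\<Union>Q \<subseteq> V" unfolding UQ using D(1)[OF P(1)] uv by (auto simp: f_def)
      have "inj_on f (\<Union>P)" by (rule inj_on_subset[OF inj_f]) (use D(1)[OF P(1)] P(2) in blast)
      then show "shape Q = M" unfolding Q using D(2)[OF P(1)] by (simp add: shape_image)
    next
      fix A B x y assume "A \<in> Q" "B \<in> Q" "A \<noteq> B" "x \<in> A" "y \<in> B"
      then obtain A' B' x' y' where *: "A' \<in> P" "B' \<in> P" "A' \<noteq> B'" "x' \<in> A'" "y' \<in> B'" "x = f x'" "y = f y'"
        unfolding Q by blast
      then have "(x', y') \<in> E" using D(3)[OF P(1)] by blast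
      moreover have "(id(u := v)) x = x'" "(id(u := v)) y = y'" using fback * by blast+
      ultimately show "((id(u := v)) x, (id(u := v)) y) \<in> E" by simp
    qed
    moreover have "u \<in> \<Union>Q" unfolding UQ using P(3) by (intro image_eqI[of _ _ v]) (auto simp: f_def)
    moreover have "v \<notin> \<Union>Q" unfolding UQ using uv(3) by (auto simp: f_def)
    ultimately show "Q \<in> {P \<in> ?C'. u \<in> \<Union>P \<and> v \<notin> \<Union>P}" by blast
  qed
  have "inj_on ((`) ((`) f)) S2"
  proof (intro inj_on_image)
    show "inj_on f (\<Union>(\<Union>S2))"
      by (rule inj_on_subset[OF inj_f]) (use D(1) in \<open>unfold S2_def, blast\<close>)
  qed
  then have card2: "card ((`) ((`) f) ` S2) = card S2" by (rule card_image)
  have fin: "finite ?C'" using finV by (rule finite_part_copies)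
  have disj: "S1 \<inter> S3 = {}" "(S1 \<union> S3) \<inter> (`) ((`) f) ` S2 = {}"
    using S2 by (auto simp: S1_def S3_def)
  have sub: "S1 \<union> S3 \<union> (`) ((`) f) ` S2 \<subseteq> ?C'" using S1 S2 S3 by blast
  have f1: "finite S1" "finite S3" "finite ((`) ((`) f) ` S2)"
    by (rule finite_subset[OF _ fin], use sub in blast)+
  have "card S1 + card S2 + card S3 = card (S1 \<union> S3 \<union> (`) ((`) f) ` S2)"
    using disj f1 card2 by (simp add: card_Un_disjoint)
  also have "\<dots> \<le> card ?C'" by (rule card_mono[OF fin sub])
  finally show ?thesis by (simp add: S1_def S2_def S3_def)
qed

text \<open>
  Both ways of cloning must not gain copies, so \<open>u\<close> and \<open>v\<close> are in equally many copies, and then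
  neither way loses any.
\<close>

lemma extremal_clone:
  assumes ex: "extremal M k V E" and uv: "u \<in> V" "v \<in> V" "u \<noteq> v" "(u, v) \<notin> E"
  shows "extremal M k V (clone V E u v)"
proof -
  have E: "is_graph V E" "no_clique k V E" using ex by (auto simp: extremal_def)
  have finV: "finite V" and vu: "(v, u) \<notin> E" using E uv(4) by (auto simp: is_graph_def dest: symD)
  let ?C = "part_copies M V E"
  define n where "n = (\<lambda>b c. card {P \<in> ?C. (u \<in> \<Union>P) = b \<and> (v \<in> \<Union>P) = c})"
  have fin: "finite ?C" using finV by (rule finite_part_copies)
  \<comment> \<open>the copies are sorted by whether they contain \<open>u\<close> and whether they contain \<open>v\<close>\<close>
  have split: "card {P \<in> ?C. R P} = card {P \<in> ?C. R P \<and> S P} + card {P \<in> ?C. R P \<and> \<not> S P}" for R S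
  proof -
    have "{P \<in> ?C. R P} = {P \<in> ?C. R P \<and> S P} \<union> {P \<in> ?C. R P \<and> \<not> S P}" by blast
    then show ?thesis using fin by (subst card_Un_disjoint[symmetric]) auto
  qed
  have total: "card ?C = n True True + n True False + n False True + n False False"
    using split[of "\<lambda>_. True" "\<lambda>P. u \<in> \<Union>P"] split[of "\<lambda>P. u \<in> \<Union>P" "\<lambda>P. v \<in> \<Union>P"]
      split[of "\<lambda>P. u \<notin> \<Union>P" "\<lambda>P. v \<in> \<Union>P"] by (simp add: n_def)
  have g: "card (part_copies M V (clone V E x y)) \<le> card ?C" if "y \<in> V" for x y
    using ex is_graph_clone[OF E(1)] no_clique_clone[OF E that] by (simp add: extremal_def)
  have "n False True + n False False + n False True + n True True \<le> card (part_copies M V (clone V E u v))"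
    using part_copies_clone_lower_bound[OF E(1) uv, of M]
      split[of "\<lambda>P. u \<notin> \<Union>P" "\<lambda>P. v \<in> \<Union>P"] by (simp add: n_def)
  moreover have "n True False + n False False + n True False + n True True \<le> card (part_copies M V (clone V E v u))"
    using part_copies_clone_lower_bound[OF E(1) uv(2,1) _ vu, of M] uv(3)
      split[of "\<lambda>P. v \<notin> \<Union>P" "\<lambda>P. u \<in> \<Union>P"] by (simp add: n_def conj_commute)
  ultimately have "card ?C \<le> card (part_copies M V (clone V E u v))"
    using g[OF uv(1), of v] total by linarith
  then show ?thesis
    using ex is_graph_clone[OF E(1)] no_clique_clone[OF E uv(2)]
    by (auto simp: extremal_def intro: order.trans)
qed

text \<open>
  The vertex \<open>u\<close> leaves its own class of twins and joins the class of \<open>v\<close>, which is at least as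
  large as the old one was including \<open>u\<close>. All other vertices keep their twins. This is the
  potential that makes symmetrization terminate.
\<close>

lemma card_twin_pairs_clone:
  assumes E: "is_graph V E" and uv: "u \<in> V" "v \<in> V" "u \<noteq> v" and nt: "E `` {u} \<noteq> E `` {v}"
    and le: "card {x \<in> V. E `` {x} = E `` {u}} \<le> card {x \<in> V. E `` {x} = E `` {v}}"
  shows "card (twin_pairs V E) < card (twin_pairs V (clone V E u v))"
proof -
  have finV: "finite V" and EV: "E \<subseteq> V \<times> V" using E by (auto simp: is_graph_def)
  define cl where "cl w = {x \<in> V. E `` {x} = E `` {w}}" for w
  define R where "R = twin_pairs V E \<inter> (V - {u}) \<times> (V - {u})"
  \<comment> \<open>the pairs of twins other than those in \<open>R\<close> involve \<open>u\<close>; \<open>Z\<close> is the set of twins of \<open>u\<close> other than \<open>u\<close>\<close>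
  define N where "N Z = R \<union> (insert u Z \<times> {u} \<union> {u} \<times> Z)" for Z
  have finR: "finite R" unfolding R_def using finV by auto
  have cardN: "card (N Z) = card R + (2 * card Z + 1)" if "Z \<subseteq> V - {u}" for Z
  proof -
    have fZ: "finite Z" using that finV by (meson finite_Diff finite_subset)
    have "card (insert u Z \<times> {u} \<union> {u} \<times> Z) = card (insert u Z \<times> {u}) + card ({u} \<times> Z)"
      using that fZ by (intro card_Un_disjoint) auto
    also have "\<dots> = 2 * card Z + 1"
    proof -
      have "u \<notin> Z" using that by blast
      then show ?thesis using fZ by (simp add: card_cartesian_product)
    qed
    finally have 1: "card (insert u Z \<times> {u} \<union> {u} \<times> Z) = 2 * card Z + 1" .
    have "card (N Z) = card R + card (insert u Z \<times> {u} \<union> {u} \<times> Z)"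
      unfolding N_def by (rule card_Un_disjoint) (use finR fZ R_def in auto)
    then show ?thesis using 1 by simp
  qed
  have finT: "finite (twin_pairs V (clone V E u v))"
    by (rule finite_subset[of _ "V \<times> V"]) (use finV in \<open>auto simp: twin_pairs_def\<close>)
  have "twin_pairs V E = N (cl u - {u})"
    using uv by (auto simp: N_def R_def cl_def twin_pairs_def)
  moreover have "card (cl u - {u}) < card (cl v)"
  proof -
    have "finite (cl u)" "u \<in> cl u" using finV uv by (auto simp: cl_def)
    then have "card (cl u - {u}) < card (cl u)" by (rule card_Diff1_less)
    then show ?thesis using le by (simp add: cl_def)
  qed
  moreover have "cl u - {u} \<subseteq> V - {u}" "cl v \<subseteq> V - {u}"
    using nt unfolding cl_def by blast+
  ultimately have "card (twin_pairs V E) < card (N (cl v))"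
    using cardN by simp
  also have "\<dots> \<le> card (twin_pairs V (clone V E u v))"
  proof (rule card_mono[OF finT])
    have *: "(x, y) \<in> twin_pairs V (clone V E u v)"
      if "x \<in> V" "y \<in> V" "E `` {(id(u := v)) x} = E `` {(id(u := v)) y}" for x y
    proof -
      have "(x, z) \<in> clone V E u v \<longleftrightarrow> (y, z) \<in> clone V E u v" for z
        using that unfolding clone_def by blast
      then show ?thesis using that(1,2) by (auto simp: twin_pairs_def)
    qed
    show "N (cl v) \<subseteq> twin_pairs V (clone V E u v)"
    proof
      fix e assume "e \<in> N (cl v)"
      moreover obtain x y where e: "e = (x, y)" by fastforce
      ultimately consider "(x, y) \<in> R" | "x = u" "y = u" | "x \<in> cl v" "y = u" | "x = u" "y \<in> cl v"
        by (auto simp: N_def)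
      then show "e \<in> twin_pairs V (clone V E u v)"
        unfolding e by cases (rule *; use uv nt in \<open>auto simp: R_def cl_def twin_pairs_def\<close>)+
    qed
  qed
  finally show ?thesis .
qed

section \<open>Coloured graphs\<close>

definition col_edges :: "'v set \<Rightarrow> ('v \<Rightarrow> nat) \<Rightarrow> ('v \<times> 'v) set" where
  "col_edges V c = {(x, y). x \<in> V \<and> y \<in> V \<and> c x \<noteq> c y}"

text \<open>
  The union of the parts of a copy, in a graph coloured with \<open>r\<close> colours: the parts are recovered by
  intersecting with the colour classes.
\<close>

definition col_sets :: "nat multiset \<Rightarrow> nat \<Rightarrow> 'v set \<Rightarrow> ('v \<Rightarrow> nat) \<Rightarrow> 'v set set" where
  "col_sets M r V c =
     {U. U \<subseteq> V \<and> image_mset (\<lambda>i. card {x \<in> U. c x = i}) (mset_set {..<r}) = M}"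

lemma is_graph_col_edges:
  assumes "finite V"
  shows "is_graph V (col_edges V c)"
proof -
  have "sym (col_edges V c)" by (rule symI) (auto simp: col_edges_def)
  then show ?thesis using assms by (auto simp: is_graph_def col_edges_def irrefl_def)
qed

lemma no_clique_col_edges:
  assumes "c ` V \<subseteq> {..<r}"
  shows "no_clique (Suc r) V (col_edges V c)"
  unfolding no_clique_def
proof
  assume "\<exists>S\<subseteq>V. card S = Suc r \<and> (\<forall>x\<in>S. \<forall>y\<in>S. x \<noteq> y \<longrightarrow> (x, y) \<in> col_edges V c)"
  then obtain S where S: "S \<subseteq> V" "card S = Suc r" "\<forall>x\<in>S. \<forall>y\<in>S. x \<noteq> y \<longrightarrow> c x \<noteq> c y"
    by (auto simp: col_edges_def)
  then have "inj_on c S" by (auto simp: inj_on_def)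
  moreover have "c ` S \<subseteq> {..<r}" using S(1) assms by blast
  ultimately have "card S \<le> card {..<r}" by (intro card_inj_on_le) auto
  then show False using S(2) by simp
qed

text \<open>
  Colouring a vertex by its neighbourhood makes adjacency the same as having different colours.
  Representatives of the neighbourhoods form a clique, which bounds the number of colours.
\<close>

lemma colouring_if_nonadjacent_twins:
  assumes E: "is_graph V E" "no_clique (Suc r) V E"
    and tw: "\<And>x y. x \<in> V \<Longrightarrow> y \<in> V \<Longrightarrow> (x, y) \<notin> E \<Longrightarrow> E `` {x} = E `` {y}"
  obtains c :: "'v \<Rightarrow> nat" where "c ` V \<subseteq> {..<r}" "E = col_edges V c"
proof -
  define f where "f x = E `` {x}" for x
  have V: "finite V" "E \<subseteq> V \<times> V" "irrefl E" using E by (auto simp: is_graph_def)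
  have f: "(x, y) \<in> E \<longleftrightarrow> f x \<noteq> f y" if "x \<in> V" "y \<in> V" for x y
  proof
    assume "(x, y) \<in> E"
    moreover have "(y, y) \<notin> E" using V(3) by (auto simp: irrefl_def)
    ultimately show "f x \<noteq> f y" by (auto simp: f_def)
  qed (use tw[OF that] in \<open>auto simp: f_def\<close>)
  obtain S where S: "S \<subseteq> V" "inj_on f S" "f ` V = f ` S" by (metis order_refl subset_image_inj)
  have card: "card (f ` V) \<le> r"
  proof (rule ccontr)
    assume "\<not> card (f ` V) \<le> r"
    then have "Suc r \<le> card S" using S by (simp add: card_image)
    then obtain S' where S': "S' \<subseteq> S" "card S' = Suc r" by (meson obtain_subset_with_card_n)
    moreover have "(x, y) \<in> E" if "x \<in> S'" "y \<in> S'" "x \<noteq> y" for x y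
    proof -
      have "x \<in> S" "y \<in> S" using that S'(1) by auto
      then have "f x \<noteq> f y" "x \<in> V" "y \<in> V" using that(3) S(1,2) by (auto dest: inj_onD)
      then show ?thesis using f by blast
    qed
    ultimately show False using E(2) S(1) unfolding no_clique_def by blast
  qed
  obtain h where h: "bij_betw h (f ` V) {0..<card (f ` V)}"
    using ex_bij_betw_finite_nat[of "f ` V"] V(1) by blast
  define c where "c x = h (f x)" for x
  have hlt: "h y < r" if "y \<in> f ` V" for y
    using bij_betwE[OF h] that card by fastforce
  then have "c ` V \<subseteq> {..<r}" by (auto simp: c_def)
  moreover have "E = col_edges V c"
  proof -
    have "c x = c y \<longleftrightarrow> f x = f y" if "x \<in> V" "y \<in> V" for x y
      unfolding c_def using that by (intro inj_on_eq_iff[OF bij_betw_imp_inj_on[OF h]] imageI)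
    then show ?thesis using f V(2) by (auto simp: col_edges_def)
  qed
  ultimately show ?thesis using that by blast
qed

definition classes :: "nat \<Rightarrow> ('v \<Rightarrow> nat) \<Rightarrow> 'v set \<Rightarrow> 'v set set" where
  "classes r c U = (\<lambda>i. {x \<in> U. c x = i}) ` {..<r}"

lemma Union_classes:
  assumes "c ` U \<subseteq> {..<r}"
  shows "\<Union>(classes r c U) = U"
proof -
  have "c x < r" if "x \<in> U" for x using assms that by blast
  then show ?thesis by (auto simp: classes_def)
qed

lemma shape_classes:
  assumes "\<And>i. i < r \<Longrightarrow> {x \<in> U. c x = i} \<noteq> {}"
  shows "shape (classes r c U) = image_mset (\<lambda>i. card {x \<in> U. c x = i}) (mset_set {..<r})"
proof -
  have "inj_on (\<lambda>i. {x \<in> U. c x = i}) {..<r}"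
  proof (rule inj_onI)
    fix i j assume ij: "i \<in> {..<r}" "{x \<in> U. c x = i} = {x \<in> U. c x = j}"
    then obtain x where "x \<in> U" "c x = i" using assms[of i] by auto
    with ij(2) show "i = j" by blast
  qed
  then show ?thesis
    unfolding shape_def classes_def by (simp add: multiset.map_comp comp_def flip: image_mset_mset_set)
qed

lemma classes_in_part_copies:
  assumes U: "U \<in> col_sets M r V c" and c: "c ` V \<subseteq> {..<r}" and M: "0 \<notin># M"
  shows "classes r c U \<in> part_copies M V (col_edges V c)"
proof -
  have UV: "U \<subseteq> V" and sh: "image_mset (\<lambda>i. card {x \<in> U. c x = i}) (mset_set {..<r}) = M"
    using U by (auto simp: col_sets_def)
  have ne: "{x \<in> U. c x = i} \<noteq> {}" if "i < r" for i
  proof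
    assume "{x \<in> U. c x = i} = {}"
    then have "0 = card {x \<in> U. c x = i}" by (simp only: card.empty)
    then have "0 \<in># M" unfolding sh[symmetric] using that by auto
    then show False using M by simp
  qed
  have "\<Union>(classes r c U) \<subseteq> V" using UV by (auto simp: classes_def)
  moreover have "A \<times> B \<subseteq> col_edges V c" if "A \<in> classes r c U" "B \<in> classes r c U" "A \<noteq> B" for A B
    using that UV by (auto simp: classes_def col_edges_def)
  moreover have "shape (classes r c U) = M" using shape_classes[OF ne] sh by simp
  ultimately show ?thesis unfolding part_copies_def by blast
qed

text \<open>
  Different parts of a copy use different colours. There are as many parts as colours, so
  each part has exactly one colour and the parts are the colour classes of their union.
\<close>

lemma card_part_copies_col_edges:
  assumes V: "finite V" and c: "c ` V \<subseteq> {..<r}" and M: "size M = r" "0 \<notin># M"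
  shows "card (part_copies M V (col_edges V c)) = card (col_sets M r V c)"
proof -
  define cls where "cls U i = {x \<in> U. c x = i}" for U i
  have classes: "classes r c U = cls U ` {..<r}" for U by (simp add: classes_def cls_def)
  let ?g = "classes r c"
  have un: "\<Union>(?g U) = U" if "U \<in> col_sets M r V c" for U
    using that c by (intro Union_classes) (auto simp: col_sets_def)
  have inj: "inj_on ?g (col_sets M r V c)"
  proof (rule inj_onI)
    fix U W assume U: "U \<in> col_sets M r V c" and W: "W \<in> col_sets M r V c" and "?g U = ?g W"
    then have "\<Union>(?g U) = \<Union>(?g W)" by (simp only:)
    then show "U = W" unfolding un[OF U] un[OF W] .
  qed
  have image: "?g ` col_sets M r V c = part_copies M V (col_edges V c)"
  proof (intro equalityI subsetI)
    fix P assume "P \<in> ?g ` col_sets M r V c"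
    then show "P \<in> part_copies M V (col_edges V c)" using classes_in_part_copies c M(2) by blast
  next
    fix P assume P: "P \<in> part_copies M V (col_edges V c)"
    note D = part_copiesD[OF is_graph_col_edges[OF V] P M(2)]
    have sub: "\<Union>P \<subseteq> V" and sh: "shape P = M"
      and col: "\<And>A B x y. A \<in> P \<Longrightarrow> B \<in> P \<Longrightarrow> A \<noteq> B \<Longrightarrow> x \<in> A \<Longrightarrow> y \<in> B \<Longrightarrow> c x \<noteq> c y"
      using P unfolding part_copies_def col_edges_def by blast+
    have "card P = r" using M(1) unfolding sh[symmetric] shape_def by simp
    \<comment> \<open>\<open>k A\<close> is the colour of some vertex of \<open>A\<close>; it will turn out to be the colour of all of them\<close>
    define k where "k A = c (SOME x. x \<in> A)" for A
    have k: "\<exists>x\<in>A. c x = k A" if "A \<in> P" for A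
    proof -
      have "A \<noteq> {}" using D(3) that by auto
      then have "(SOME x. x \<in> A) \<in> A" by (simp add: some_in_eq)
      then show ?thesis unfolding k_def by blast
    qed
    have inj: "inj_on k P"
    proof (rule inj_onI)
      fix A B assume AB: "A \<in> P" "B \<in> P" "k A = k B"
      obtain x y where "x \<in> A" "c x = k A" "y \<in> B" "c y = k B" using k AB by meson
      then show "A = B" using col[OF AB(1,2), of x y] AB(3) by auto
    qed
    have "k A < r" if A: "A \<in> P" for A
    proof -
      obtain x where "x \<in> A" "c x = k A" using k[OF A] by blast
      moreover from this have "x \<in> V" using A sub by blast
      ultimately show ?thesis using c by (metis image_subset_iff lessThan_iff)
    qed
    then have "k ` P \<subseteq> {..<r}" by blast
    then have kP: "k ` P = {..<r}"
      using inj \<open>card P = r\<close> by (intro card_subset_eq) (auto simp: card_image)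
    have ck: "c x = k A" if "A \<in> P" "x \<in> A" for A x
    proof -
      have "c x \<in> k ` P" unfolding kP using that sub c by blast
      then obtain B where B: "B \<in> P" "c x = k B" by blast
      obtain y where "y \<in> B" "c y = k B" using k[OF B(1)] by blast
      with col[OF that(1) B(1) _ that(2), of y] B(2) show ?thesis by auto
    qed
    have cls: "cls (\<Union>P) (k A) = A" if "A \<in> P" for A
    proof -
      have "B = A" if "B \<in> P" "x \<in> B" "c x = k A" for B x
        using ck[OF that(1,2)] that inj \<open>A \<in> P\<close> by (auto simp: inj_on_def)
      then have "x \<in> A" if "x \<in> \<Union>P" "c x = k A" for x using that by blast
      then show ?thesis using ck that unfolding cls_def by blast
    qed
    have "(\<lambda>A. cls (\<Union>P) (k A)) ` P = P" by (simp only: cls image_ident cong: image_cong)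
    then have 1: "P = ?g (\<Union>P)" unfolding classes kP[symmetric] image_image by (rule sym)
    have "image_mset (\<lambda>i. card (cls (\<Union>P) i)) (mset_set {..<r})
        = image_mset (\<lambda>A. card (cls (\<Union>P) (k A))) (mset_set P)"
      unfolding kP[symmetric] image_mset_mset_set[OF inj, symmetric] by (simp add: multiset.map_comp comp_def)
    also have "\<dots> = shape P"
      unfolding shape_def using D(1) cls by (intro image_mset_cong) auto
    finally have "\<Union>P \<in> col_sets M r V c" using sub sh by (simp add: col_sets_def cls_def)
    with 1 show "P \<in> ?g ` col_sets M r V c" by blast
  qed
  show ?thesis unfolding image[symmetric] by (rule card_image[OF inj])
qed

section \<open>Moving a vertex to another colour class\<close>

text \<open>
  The number of ways to extend a partial copy with class sizes \<open>K\<close> by subsets of two further classes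
  with \<open>a\<close> and \<open>b\<close> vertices to one with class sizes \<open>M\<close>.
\<close>

definition completions :: "nat multiset \<Rightarrow> nat multiset \<Rightarrow> nat \<Rightarrow> nat \<Rightarrow> nat" where
  "completions K M a b = (\<Sum>(p, q)\<in>{(p, q). K + {#p, q#} = M}. (a choose p) * (b choose q))"

lemma completions_eq_pair_choices:
  assumes "K + {#p, q#} = M"
  shows "completions K M a b = pair_choices p q a b"
proof -
  have "{(p', q'). K + {#p', q'#} = M} = {(p, q), (q, p)}"
  proof -
    have "K + {#p', q'#} = M \<longleftrightarrow> {#p', q'#} = {#p, q#}" for p' q'
      unfolding assms[symmetric] by (rule add_left_cancel)
    then show ?thesis by (auto simp: add_eq_conv_diff)
  qed
  then show ?thesis by (simp add: completions_def pair_choices_def)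
qed

lemma completions_eq_0:
  assumes "\<And>p q. K + {#p, q#} \<noteq> M"
  shows "completions K M a b = 0"
proof -
  have "{(p, q). K + {#p, q#} = M} = {}" using assms by blast
  then show ?thesis unfolding completions_def by (simp only: sum.empty)
qed

lemma card_two_class_subsets:
  assumes "finite A" "finite B" "A \<inter> B = {}"
  shows "card {Z. Z \<subseteq> A \<union> B \<and> K + {#card (Z \<inter> A), card (Z \<inter> B)#} = M} = completions K M (card A) (card B)"
    (is "card ?Z = _")
proof -
  let ?S = "{(p, q). K + {#p, q#} = M}"
  let ?T = "SIGMA pq:?S. {X. X \<subseteq> A \<and> card X = fst pq} \<times> {Y. Y \<subseteq> B \<and> card Y = snd pq}"
  have "?S \<subseteq> set_mset M \<times> set_mset M" by auto
  then have finS: "finite ?S" by (rule finite_subset) simp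
  have "bij_betw (\<lambda>Z. ((card (Z \<inter> A), card (Z \<inter> B)), (Z \<inter> A, Z \<inter> B))) ?Z ?T"
  proof (rule bij_betw_byWitness[where f' = "\<lambda>(_, X, Y). X \<union> Y"])
    have eqs: "(X \<union> Y) \<inter> A = X" "(X \<union> Y) \<inter> B = Y" if "X \<subseteq> A" "Y \<subseteq> B" for X Y
      using that assms(3) by blast+
    show "\<forall>t\<in>?T. (\<lambda>Z. ((card (Z \<inter> A), card (Z \<inter> B)), (Z \<inter> A, Z \<inter> B))) ((\<lambda>(_, X, Y). X \<union> Y) t) = t"
      using eqs by auto
    show "(\<lambda>(_, X, Y). X \<union> Y) ` ?T \<subseteq> ?Z"
      using eqs by auto
  qed auto
  then have "card ?Z = card ?T" by (rule bij_betw_same_card)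
  also have "\<dots> = (\<Sum>pq\<in>?S. card ({X. X \<subseteq> A \<and> card X = fst pq} \<times> {Y. Y \<subseteq> B \<and> card Y = snd pq}))"
    using finS assms by (intro card_SigmaI) auto
  also have "\<dots> = completions K M (card A) (card B)"
    unfolding completions_def
    by (intro sum.cong) (auto simp: card_cartesian_product n_subsets assms)
  finally show ?thesis .
qed

definition rest_shape :: "nat \<Rightarrow> nat \<Rightarrow> nat \<Rightarrow> ('v \<Rightarrow> nat) \<Rightarrow> 'v set \<Rightarrow> nat multiset" where
  "rest_shape r i j c U = image_mset (\<lambda>l. card {x \<in> U. c x = l}) (mset_set ({..<r} - {i, j}))"

text \<open>
  The sets are sorted by their trace \<open>U\<close> outside the classes \<open>i\<close> and \<open>j\<close>. A vertex that moves
  between these two classes changes only the last two arguments of each summand.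
\<close>

lemma card_col_sets:
  assumes V: "finite V" and ij: "i < r" "j < r" "i \<noteq> j"
  shows "card (col_sets M r V c) = (\<Sum>U\<in>Pow {x \<in> V. c x \<noteq> i \<and> c x \<noteq> j}.
    completions (rest_shape r i j c U) M (card {x \<in> V. c x = i}) (card {x \<in> V. c x = j}))"
proof -
  define A where "A = {x \<in> V. c x = i}"
  define B where "B = {x \<in> V. c x = j}"
  define R where "R = {x \<in> V. c x \<noteq> i \<and> c x \<noteq> j}"
  define F where "F U = {Z. Z \<subseteq> A \<union> B \<and> rest_shape r i j c U + {#card (Z \<inter> A), card (Z \<inter> B)#} = M}" for U
  have fin: "finite A" "finite B" "finite R" using V by (auto simp: A_def B_def R_def)
  have "A \<inter> B = {}" using ij by (auto simp: A_def B_def)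
  have split: "mset_set {..<r} = mset_set ({..<r} - {i, j}) + {#i, j#}"
  proof -
    have "{..<r} = ({..<r} - {i, j}) \<union> {i, j}" using ij by auto
    then have "mset_set {..<r} = mset_set ({..<r} - {i, j}) + mset_set {i, j}"
      by (metis Diff_disjoint Int_commute finite_Diff finite_lessThan finite.intros mset_set_Union)
    then show ?thesis using ij(3) by simp
  qed
  have sh: "image_mset (\<lambda>l. card {x \<in> U \<union> Z. c x = l}) (mset_set {..<r})
      = rest_shape r i j c U + {#card (Z \<inter> A), card (Z \<inter> B)#}"
    if "U \<subseteq> R" "Z \<subseteq> A \<union> B" for U Z
  proof -
    have "{x \<in> U \<union> Z. c x = i} = Z \<inter> A" "{x \<in> U \<union> Z. c x = j} = Z \<inter> B"
      using that by (auto simp: R_def A_def B_def)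
    moreover have "image_mset (\<lambda>l. card {x \<in> U \<union> Z. c x = l}) (mset_set ({..<r} - {i, j})) = rest_shape r i j c U"
      unfolding rest_shape_def
    proof (rule image_mset_cong)
      fix l assume "l \<in># mset_set ({..<r} - {i, j})"
      then have "{x \<in> U \<union> Z. c x = l} = {x \<in> U. c x = l}"
        using that by (auto simp: A_def B_def)
      then show "card {x \<in> U \<union> Z. c x = l} = card {x \<in> U. c x = l}" by simp
    qed
    ultimately show ?thesis unfolding split by simp
  qed
  have VR: "V = R \<union> (A \<union> B)" "R \<inter> (A \<union> B) = {}" by (auto simp: R_def A_def B_def)
  have "bij_betw (\<lambda>(U, Z). U \<union> Z) (SIGMA U:Pow R. F U) (col_sets M r V c)"
  proof (rule bij_betw_byWitness[where f' = "\<lambda>W. (W \<inter> R, W \<inter> (A \<union> B))"])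
    show "\<forall>t\<in>SIGMA U:Pow R. F U. (\<lambda>W. (W \<inter> R, W \<inter> (A \<union> B))) ((\<lambda>(U, Z). U \<union> Z) t) = t"
      using VR(2) by (auto simp: F_def)
    show "\<forall>W\<in>col_sets M r V c. (\<lambda>(U, Z). U \<union> Z) ((\<lambda>W. (W \<inter> R, W \<inter> (A \<union> B))) W) = W"
      using VR(1) by (auto simp: col_sets_def)
    show "(\<lambda>(U, Z). U \<union> Z) ` (SIGMA U:Pow R. F U) \<subseteq> col_sets M r V c"
    proof (rule image_subsetI)
      fix t assume "t \<in> (SIGMA U:Pow R. F U)"
      then obtain U Z where UZ: "t = (U, Z)" "U \<subseteq> R" "Z \<in> F U" by blast
      then have "Z \<subseteq> A \<union> B" "rest_shape r i j c U + {#card (Z \<inter> A), card (Z \<inter> B)#} = M"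
        by (simp_all add: F_def)
      moreover from this have "U \<union> Z \<subseteq> V" using UZ(2) VR(1) by blast
      ultimately show "(case t of (U, Z) \<Rightarrow> U \<union> Z) \<in> col_sets M r V c"
        unfolding UZ(1) col_sets_def using sh[OF UZ(2)] by simp
    qed
    show "(\<lambda>W. (W \<inter> R, W \<inter> (A \<union> B))) ` col_sets M r V c \<subseteq> (SIGMA U:Pow R. F U)"
    proof (rule image_subsetI)
      fix W assume W: "W \<in> col_sets M r V c"
      then have "W = (W \<inter> R) \<union> (W \<inter> (A \<union> B))" using VR(1) by (auto simp: col_sets_def)
      with W sh[of "W \<inter> R" "W \<inter> (A \<union> B)"]
      have "rest_shape r i j c (W \<inter> R) + {#card (W \<inter> (A \<union> B) \<inter> A), card (W \<inter> (A \<union> B) \<inter> B)#} = M"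
        by (simp add: col_sets_def)
      then show "(W \<inter> R, W \<inter> (A \<union> B)) \<in> (SIGMA U:Pow R. F U)" unfolding F_def by blast
    qed
  qed
  then have "card (col_sets M r V c) = card (SIGMA U:Pow R. F U)"
    by (rule bij_betw_same_card[symmetric])
  also have "\<dots> = (\<Sum>U\<in>Pow R. card (F U))"
    using fin by (intro card_SigmaI) (auto simp: F_def)
  also have "\<dots> = (\<Sum>U\<in>Pow R. completions (rest_shape r i j c U) M (card A) (card B))"
    unfolding F_def card_two_class_subsets[OF fin(1,2) \<open>A \<inter> B = {}\<close>] ..
  finally show ?thesis by (simp only: A_def B_def R_def)
qed

lemma card_col_sets_two:
  assumes "finite V" "c ` V \<subseteq> {..<2}"
  shows "card (col_sets {#s, t#} 2 V c) = pair_choices s t (card {x \<in> V. c x = 0}) (card {x \<in> V. c x = 1})"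
proof -
  have none: "{x \<in> V. c x \<noteq> 0 \<and> c x \<noteq> 1} = {}" using assms(2) by (fastforce simp: less_2_cases_iff)
  have rest: "rest_shape 2 0 1 c {} = {#}"
  proof -
    have "{..<2} - {0, 1 :: nat} = {}" by auto
    then show ?thesis by (simp only: rest_shape_def) simp
  qed
  have "completions {#} {#s, t#} a b = pair_choices s t a b" for a b
    by (rule completions_eq_pair_choices) simp
  then show ?thesis using card_col_sets[OF assms(1), of 0 2 1 "{#s, t#}" c]
    unfolding none by (simp add: rest[simplified])
qed

text \<open>
  No term of the sum over traces decreases, because a vanishing term cannot; a positive term exists
  by \<open>pos\<close> and increases by \<open>step\<close>.
\<close>

lemma recolour_increases_copies:
  assumes V: "finite V" and ij: "i < r" "j < r" "i \<noteq> j" and x: "x \<in> V" "c x = i"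
    and ab: "card {x \<in> V. c x = i} = Suc a" "card {x \<in> V. c x = j} = b"
    and pos: "0 < card (col_sets M r V c)"
    and step: "\<And>K p q. K + {#p, q#} = M \<Longrightarrow> 0 < pair_choices p q (Suc a) b \<Longrightarrow>
      pair_choices p q (Suc a) b < pair_choices p q a (Suc b)"
  shows "card (col_sets M r V c) < card (col_sets M r V (c(x := j)))"
proof -
  let ?c = "c(x := j)"
  define R where "R = {y \<in> V. c y \<noteq> i \<and> c y \<noteq> j}"
  have R': "{y \<in> V. ?c y \<noteq> i \<and> ?c y \<noteq> j} = R" using x by (auto simp: R_def)
  have "{y \<in> V. ?c y = i} = {y \<in> V. c y = i} - {x}" using ij by auto
  then have a': "card {y \<in> V. ?c y = i} = a" using ab x V by simp
  have "{y \<in> V. ?c y = j} = insert x {y \<in> V. c y = j}" using x by auto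
  then have b': "card {y \<in> V. ?c y = j} = Suc b" using ab x V ij by simp
  have rs: "rest_shape r i j ?c U = rest_shape r i j c U" if "U \<in> Pow R" for U
  proof -
    have "x \<notin> U" using that x by (auto simp: R_def)
    then have "{y \<in> U. ?c y = l} = {y \<in> U. c y = l}" for l by auto
    then show ?thesis by (simp add: rest_shape_def)
  qed
  have N: "card (col_sets M r V c) = (\<Sum>U\<in>Pow R. completions (rest_shape r i j c U) M (Suc a) b)"
    using card_col_sets[OF V ij, of M c] unfolding ab R_def .
  have N': "card (col_sets M r V ?c) = (\<Sum>U\<in>Pow R. completions (rest_shape r i j c U) M a (Suc b))"
    using card_col_sets[OF V ij, of M ?c] unfolding a' b' R' using rs by simp
  have le: "completions K M (Suc a) b \<le> completions K M a (Suc b)"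
    and less: "0 < completions K M (Suc a) b \<Longrightarrow> completions K M (Suc a) b < completions K M a (Suc b)" for K
  proof -
    show *: "completions K M (Suc a) b < completions K M a (Suc b)" if nz: "0 < completions K M (Suc a) b"
    proof -
      obtain p q where pq: "K + {#p, q#} = M"
        using nz completions_eq_0[of K M "Suc a" b] by (metis less_irrefl)
      show ?thesis using nz step[OF pq] unfolding completions_eq_pair_choices[OF pq] by blast
    qed
    show "completions K M (Suc a) b \<le> completions K M a (Suc b)"
      using * by (cases "completions K M (Suc a) b = 0") (auto intro: less_imp_le)
  qed
  have fin: "finite (Pow R)" using V by (simp add: R_def)
  have "\<exists>U\<in>Pow R. completions (rest_shape r i j c U) M (Suc a) b \<noteq> 0"
  proof (rule ccontr)
    assume "\<not> ?thesis"
    then have "card (col_sets M r V c) = 0" unfolding N by (intro sum.neutral) blast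
    then show False using pos by simp
  qed
  then obtain U where U: "U \<in> Pow R" "0 < completions (rest_shape r i j c U) M (Suc a) b" by blast
  show ?thesis unfolding N N'
    by (rule sum_strict_mono_ex1[OF fin]) (use le less U in auto)
qed

section \<open>Extremal graphs are balanced coloured graphs\<close>

definition balanced :: "nat \<Rightarrow> 'v set \<Rightarrow> ('v \<Rightarrow> nat) \<Rightarrow> bool" where
  "balanced r V c \<longleftrightarrow> c ` V \<subseteq> {..<r} \<and>
     (\<forall>i<r. \<forall>j<r. card {x \<in> V. c x = i} \<le> card {x \<in> V. c x = j} + 1)"

lemma sum_card_classes:
  fixes c :: "'v \<Rightarrow> nat"
  assumes "finite V" "c ` V \<subseteq> {..<r}"
  shows "(\<Sum>i<r. card {x \<in> V. c x = i}) = card V"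
proof -
  have "V = (\<Union>i<r. {x \<in> V. c x = i})" using assms(2) by auto
  moreover have "card (\<Union>i<r. {x \<in> V. c x = i}) = (\<Sum>i<r. card {x \<in> V. c x = i})"
    using assms(1) by (intro card_UN_disjoint) auto
  ultimately show ?thesis by simp
qed

lemma balanced_class_large:
  assumes "finite V" "balanced r V c" "r * m \<le> card V" "i < r"
  shows "m \<le> card {x \<in> V. c x = i}"
proof (rule ccontr)
  let ?n = "\<lambda>j. card {x \<in> V. c x = j}"
  assume "\<not> m \<le> ?n i"
  then have lt: "?n i < m" by simp
  have "?n j \<le> m" if "j < r" for j
  proof -
    have "?n j \<le> ?n i + 1" using assms(2,4) that by (auto simp: balanced_def)
    then show ?thesis using lt by simp
  qed
  then have "(\<Sum>j<r. ?n j) < (\<Sum>j<r. m)"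
    using lt assms(4) by (intro sum_strict_mono_ex1) auto
  moreover have "(\<Sum>j<r. ?n j) = card V"
    using sum_card_classes[OF assms(1)] assms(2) by (simp add: balanced_def)
  ultimately show False using assms(3) by simp
qed

lemma ex_colouring_large_classes:
  assumes "finite V" "r * m \<le> card V" "0 < r"
  obtains c :: "'v \<Rightarrow> nat" where "c ` V \<subseteq> {..<r}" "\<And>i. i < r \<Longrightarrow> m \<le> card {x \<in> V. c x = i}"
proof -
  obtain h where h: "bij_betw h {0..<card V} V" using ex_bij_betw_nat_finite[OF assms(1)] by blast
  define g where "g = the_inv_into {0..<card V} h"
  have g: "g (h k) = k" if "k < card V" for k
    unfolding g_def using bij_betw_imp_inj_on[OF h] that by (simp add: the_inv_into_f_f)
  have "m \<le> card {x \<in> V. g x mod r = i}" if i: "i < r" for i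
  proof -
    have lt: "i + r * j < card V" if "j < m" for j
    proof -
      have "i + r * j < r * Suc j" using i by simp
      also have "\<dots> \<le> r * m" using that by (intro mult_le_mono2) simp
      finally show ?thesis using assms(2) by simp
    qed
    have "inj_on (\<lambda>j. h (i + r * j)) {..<m}"
    proof (rule inj_onI)
      fix j k assume jk: "j \<in> {..<m}" "k \<in> {..<m}" "h (i + r * j) = h (i + r * k)"
      have "g (h (i + r * j)) = i + r * j" "g (h (i + r * k)) = i + r * k" using g lt jk(1,2) by auto
      then have "i + r * j = i + r * k" unfolding jk(3) by (rule trans[OF sym])
      then show "j = k" using assms(3) by simp
    qed
    moreover have "(\<lambda>j. h (i + r * j)) ` {..<m} \<subseteq> {x \<in> V. g x mod r = i}"
      using g lt bij_betwE[OF h] i by auto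
    ultimately have "card {..<m} \<le> card {x \<in> V. g x mod r = i}"
      using assms(1) by (intro card_inj_on_le) auto
    then show ?thesis by simp
  qed
  moreover have "(\<lambda>x. g x mod r) ` V \<subseteq> {..<r}" using assms(3) by (simp add: image_subset_iff)
  ultimately show ?thesis using that by blast
qed

text \<open>
  A set that uses no colour more often than the smallest part allows extends to a copy. For the
  empty set this gives the existence of copies, for an edge a copy through it.
\<close>

lemma ex_col_set_containing:
  assumes V: "finite V" and c: "c ` V \<subseteq> {..<r}" and M: "size M = r"
    and large: "\<And>p i. p \<in># M \<Longrightarrow> i < r \<Longrightarrow> p \<le> card {x \<in> V. c x = i}"
    and S: "S \<subseteq> V" "\<And>p i. p \<in># M \<Longrightarrow> i < r \<Longrightarrow> card {x \<in> S. c x = i} \<le> p"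
  obtains U where "U \<in> col_sets M r V c" "S \<subseteq> U"
proof -
  obtain ps where ps: "mset ps = M" using ex_mset by blast
  then have len: "length ps = r" using M by auto
  have "\<exists>B. {x \<in> S. c x = i} \<subseteq> B \<and> B \<subseteq> {x \<in> V. c x = i} \<and> card B = ps ! i" if "i < r" for i
  proof -
    have "ps ! i \<in># M" using that len ps by (metis nth_mem set_mset_mset)
    then show ?thesis using large S that V by (intro exists_subset_between) auto
  qed
  then have "\<forall>i\<in>{..<r}. \<exists>B. {x \<in> S. c x = i} \<subseteq> B \<and> B \<subseteq> {x \<in> V. c x = i} \<and> card B = ps ! i"
    by simp
  from bchoice[OF this] obtain B where B: "\<And>i. i < r \<Longrightarrow> {x \<in> S. c x = i} \<subseteq> B i"
    "\<And>i. i < r \<Longrightarrow> B i \<subseteq> {x \<in> V. c x = i}" "\<And>i. i < r \<Longrightarrow> card (B i) = ps ! i" by auto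
  define U where "U = (\<Union>i<r. B i)"
  have cls: "{x \<in> U. c x = i} = B i" if "i < r" for i
    using B(2) that unfolding U_def by blast
  have "image_mset (\<lambda>i. card {x \<in> U. c x = i}) (mset_set {..<r}) = image_mset ((!) ps) (mset_set {..<r})"
    using cls B(3) by (intro image_mset_cong) auto
  also have "\<dots> = mset (map ((!) ps) [0..<r])" by (simp add: atLeast0LessThan)
  also have "\<dots> = M" unfolding len[symmetric] map_nth by (rule ps)
  finally have "U \<in> col_sets M r V c" using B(2) by (auto simp: col_sets_def U_def)
  moreover have "S \<subseteq> U"
  proof
    fix x assume "x \<in> S"
    moreover from this have "c x < r" using c S(1) by blast
    ultimately show "x \<in> U" using B(1)[of "c x"] unfolding U_def by blast
  qed
  ultimately show ?thesis using that by blast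
qed

lemma finite_col_sets: "finite V \<Longrightarrow> finite (col_sets M r V c)"
  by (rule finite_subset[of _ "Pow V"]) (simp_all add: col_sets_def Pow_def Collect_mono)

lemma part_copies_mono:
  assumes "E \<subseteq> E'"
  shows "part_copies M V E \<subseteq> part_copies M V E'"
proof
  fix P assume "P \<in> part_copies M V E"
  then show "P \<in> part_copies M V E'" using order.trans[OF _ assms] by (simp add: part_copies_def)
qed

text \<open>
  Balancing two classes is required to pay off, by \<open>step\<close>, only for part sizes that can be
  completed to \<open>M\<close>, and for \<open>r = 2\<close> only for classes that exhaust \<open>V\<close>: for \<open>K\<^sub>s\<^sub>,\<^sub>t\<close> it may fail in
  small classes. The lower bound on \<open>card V\<close> leaves room for every part in every class of a balanced
  colouring.
\<close>

context
  fixes M :: "nat multiset" and r m :: nat and V :: "'v set"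
  assumes r2: "2 \<le> r" and M: "size M = r" "0 \<notin># M" "\<And>p. p \<in># M \<Longrightarrow> p \<le> m"
    and V: "finite V" "r * Suc m \<le> card V"
    and step: "\<And>K p q a b. \<lbrakk>K + {#p, q#} = M; b < a; r = 2 \<Longrightarrow> Suc a + b = card V;
        0 < pair_choices p q (Suc a) b\<rbrakk> \<Longrightarrow> pair_choices p q (Suc a) b < pair_choices p q a (Suc b)"
begin

text \<open>
  The extremal number of copies is positive since an equitable colouring provides a copy. If two
  classes differed by more than one, recolouring a vertex would gain copies.
\<close>

lemma extremal_colouring_balanced:
  assumes ex: "extremal M (Suc r) V (col_edges V c)" and c: "c ` V \<subseteq> {..<r}"
  shows "balanced r V c"
proof (rule ccontr)
  assume "\<not> balanced r V c"
  let ?n = "\<lambda>i. card {x \<in> V. c x = i}"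
  obtain i j where ij: "i < r" "j < r" "?n j + 1 < ?n i"
    using c \<open>\<not> balanced r V c\<close> unfolding balanced_def by (metis not_le)
  have max: "card (col_sets M r V c') \<le> card (col_sets M r V c)" if "c' ` V \<subseteq> {..<r}" for c'
    using ex is_graph_col_edges[OF V(1), of c'] no_clique_col_edges[OF that]
      card_part_copies_col_edges[OF V(1) that M(1,2)] card_part_copies_col_edges[OF V(1) c M(1,2)]
    unfolding extremal_def by metis
  have pos: "0 < card (col_sets M r V c)"
  proof -
    obtain c' where c': "c' ` V \<subseteq> {..<r}" "\<And>i. i < r \<Longrightarrow> Suc m \<le> card {x \<in> V. c' x = i}"
      using ex_colouring_large_classes[OF V] r2 by auto
    have "p \<le> card {x \<in> V. c' x = i}" if "p \<in># M" "i < r" for p i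
      using M(3)[OF that(1)] c'(2)[OF that(2)] by simp
    then obtain U where "U \<in> col_sets M r V c'"
      using ex_col_set_containing[OF V(1) c'(1) M(1), of "{}"] by auto
    then have "0 < card (col_sets M r V c')" using finite_col_sets[OF V(1)] by (auto simp: card_gt_0_iff)
    then show ?thesis using max[OF c'(1)] by simp
  qed
  obtain a where a: "?n i = Suc a" using ij(3) by (metis less_nat_zero_code not0_implies_Suc)
  obtain x where x: "x \<in> V" "c x = i" using a by (metis (mono_tags, lifting) card.empty empty_Collect_eq nat.distinct(1))
  have "i \<noteq> j" using ij(3) by auto
  have two: "Suc a + ?n j = card V" if "r = 2"
  proof -
    have "(\<Sum>l<r. ?n l) = ?n i + ?n j"
    proof -
      have "{..<r} = {i, j}" using that ij \<open>i \<noteq> j\<close> by auto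
      then show ?thesis using \<open>i \<noteq> j\<close> by simp
    qed
    then show ?thesis using sum_card_classes[OF V(1) c] a by simp
  qed
  have "card (col_sets M r V c) < card (col_sets M r V (c(x := j)))"
  proof (rule recolour_increases_copies[OF V(1) ij(1,2) \<open>i \<noteq> j\<close> x a refl pos])
    show "pair_choices p q (Suc a) (?n j) < pair_choices p q a (Suc (?n j))"
      if "K + {#p, q#} = M" "0 < pair_choices p q (Suc a) (?n j)" for K p q
      by (rule step[OF that(1) _ two that(2)]) (use ij(3) a in simp)
  qed
  moreover have "(c(x := j)) ` V \<subseteq> {..<r}" using c ij by auto
  ultimately show False using max by (meson not_le)
qed

lemma balanced_edge_in_copy:
  assumes c: "balanced r V c" and xy: "(x, y) \<in> col_edges V c"
  obtains P A B where "P \<in> part_copies M V (col_edges V c)" "A \<in> P" "B \<in> P" "A \<noteq> B" "x \<in> A" "y \<in> B"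
proof -
  have cr: "c ` V \<subseteq> {..<r}" using c by (simp add: balanced_def)
  have xyV: "x \<in> V" "y \<in> V" "c x \<noteq> c y" using xy by (auto simp: col_edges_def)
  have large: "p \<le> card {x \<in> V. c x = i}" if "p \<in># M" "i < r" for p i
    using M(3)[OF that(1)] balanced_class_large[OF V(1) c V(2) that(2)] by simp
  have small: "card {z \<in> {x, y}. c z = i} \<le> p" if "p \<in># M" for p i
  proof -
    have "{z \<in> {x, y}. c z = i} \<subseteq> {x} \<or> {z \<in> {x, y}. c z = i} \<subseteq> {y}" using xyV by auto
    then have "card {z \<in> {x, y}. c z = i} \<le> 1" using card_mono[of "{x}"] card_mono[of "{y}"] by fastforce
    moreover have "1 \<le> p" using that M(2) by (cases p) auto
    ultimately show ?thesis by simp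
  qed
  have "{x, y} \<subseteq> V" using xyV by simp
  then obtain U where U: "U \<in> col_sets M r V c" "{x, y} \<subseteq> U"
    using ex_col_set_containing[OF V(1) cr M(1) large _ small] by blast
  let ?A = "\<lambda>z. {w \<in> U. c w = c z}"
  have "?A z \<in> classes r c U" if "z \<in> V" for z using that cr by (auto simp: classes_def)
  moreover have "?A x \<noteq> ?A y" using U(2) xyV(3) by auto
  ultimately show ?thesis
    using that[OF classes_in_part_copies[OF U(1) cr M(2)], of "?A x" "?A y"] xyV U(2) by auto
qed

text \<open>
  The coloured graph has at least as many copies and is therefore extremal and balanced, with
  the same copies. Since each of its edges lies in a copy, \<open>E\<close> contains all of them.
\<close>

lemma extremal_eq_if_sub_colouring:
  assumes ex: "extremal M (Suc r) V E" and c: "c ` V \<subseteq> {..<r}" and sub: "E \<subseteq> col_edges V c"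
  shows "balanced r V c" "E = col_edges V c"
proof -
  let ?H = "col_edges V c"
  have H: "is_graph V ?H" "no_clique (Suc r) V ?H"
    using is_graph_col_edges[OF V(1)] no_clique_col_edges[OF c] by auto
  have copies: "part_copies M V E \<subseteq> part_copies M V ?H" using sub by (rule part_copies_mono)
  have fin: "finite (part_copies M V ?H)" using V(1) by (rule finite_part_copies)
  have le: "card (part_copies M V ?H) \<le> card (part_copies M V E)"
    using ex H by (simp add: extremal_def)
  then have same: "part_copies M V E = part_copies M V ?H"
    using copies fin by (metis card_seteq)
  then have "extremal M (Suc r) V ?H" using ex H by (simp add: extremal_def)
  then show b: "balanced r V c" using c by (rule extremal_colouring_balanced)
  show "E = ?H"
  proof (intro equalityI sub subsetI)
    fix e assume "e \<in> ?H"
    moreover obtain x y where e: "e = (x, y)" by fastforce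
    ultimately obtain P A B where P: "P \<in> part_copies M V ?H" "A \<in> P" "B \<in> P" "A \<noteq> B" "x \<in> A" "y \<in> B"
      using balanced_edge_in_copy[OF b] by metis
    then have "A \<times> B \<subseteq> E" unfolding same[symmetric] by (simp add: part_copies_def)
    then show "e \<in> E" unfolding e using P(5,6) by blast
  qed
qed

text \<open>
  Induction on the number of pairs of vertices that are not twins. The clone graph is a balanced
  coloured graph by induction, and it differs from \<open>E\<close> only at \<open>u\<close>. Some colour is absent from
  the neighbourhood of \<open>u\<close> in \<open>E\<close>, for otherwise \<open>u\<close> and one neighbour of each colour would be a
  clique. Giving \<open>u\<close> this colour shows that \<open>E\<close> is contained in a coloured graph.
\<close>

lemma extremal_is_balanced_colouring:
  assumes "extremal M (Suc r) V E"
  shows "\<exists>c. balanced r V c \<and> E = col_edges V c"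
  using assms
proof (induction "card (V \<times> V) - card (twin_pairs V E)" arbitrary: E rule: less_induct)
  case less
  have E: "is_graph V E" "no_clique (Suc r) V E" using less.prems by (auto simp: extremal_def)
  have symE: "sym E" using E by (simp add: is_graph_def)
  show ?case
  proof (cases "\<forall>x\<in>V. \<forall>y\<in>V. (x, y) \<notin> E \<longrightarrow> E `` {x} = E `` {y}")
    case True
    then obtain c where "c ` V \<subseteq> {..<r}" "E = col_edges V c"
      using colouring_if_nonadjacent_twins[OF E] by blast
    then show ?thesis using extremal_colouring_balanced less.prems by blast
  next
    case False
    then obtain x y where xy: "x \<in> V" "y \<in> V" "(x, y) \<notin> E" "E `` {x} \<noteq> E `` {y}" by blast
    have "(y, x) \<notin> E" using xy(3) symE by (auto dest: symD)
    obtain u v where uv: "u \<in> V" "v \<in> V" "(u, v) \<notin> E" "E `` {u} \<noteq> E `` {v}"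
      "card {z \<in> V. E `` {z} = E `` {u}} \<le> card {z \<in> V. E `` {z} = E `` {v}}"
    proof (cases "card {z \<in> V. E `` {z} = E `` {x}} \<le> card {z \<in> V. E `` {z} = E `` {y}}")
      case True
      show ?thesis by (rule that[OF xy True])
    next
      case False
      show ?thesis by (rule that[OF xy(2,1) \<open>(y, x) \<notin> E\<close> xy(4)[symmetric]]) (use False in simp)
    qed
    have "u \<noteq> v" using uv(4) by blast
    let ?E' = "clone V E u v"
    have finT: "card (twin_pairs V ?E') \<le> card (V \<times> V)"
      by (rule card_mono) (use V(1) in \<open>auto simp: twin_pairs_def\<close>)
    have "extremal M (Suc r) V ?E'" by (rule extremal_clone[OF less.prems uv(1,2) \<open>u \<noteq> v\<close> uv(3)])
    moreover have "card (V \<times> V) - card (twin_pairs V ?E') < card (V \<times> V) - card (twin_pairs V E)"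
      using card_twin_pairs_clone[OF E(1) uv(1,2) \<open>u \<noteq> v\<close> uv(4,5)] finT by linarith
    ultimately obtain c where c: "balanced r V c" "?E' = col_edges V c" using less.hyps by blast
    have cr: "c ` V \<subseteq> {..<r}" using c(1) by (simp add: balanced_def)
    \<comment> \<open>away from \<open>u\<close> the graph is already coloured by \<open>c\<close>\<close>
    have off: "(x, y) \<in> E \<longleftrightarrow> c x \<noteq> c y" if "x \<in> V" "y \<in> V" "x \<noteq> u" "y \<noteq> u" for x y
    proof -
      have "(x, y) \<in> E \<longleftrightarrow> (x, y) \<in> ?E'" using that by (simp add: clone_def)
      then show ?thesis using that unfolding c(2) by (simp add: col_edges_def)
    qed
    have "\<exists>i<r. \<forall>x\<in>V. x \<noteq> u \<and> c x = i \<longrightarrow> (u, x) \<notin> E"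
    proof (rule ccontr)
      assume "\<not> ?thesis"
      then obtain f where f: "\<And>i. i < r \<Longrightarrow> f i \<in> V \<and> f i \<noteq> u \<and> c (f i) = i \<and> (u, f i) \<in> E" by metis
      define S where "S = insert u (f ` {..<r})"
      have "inj_on f {..<r}" by (rule inj_onI) (metis f lessThan_iff)
      moreover have "u \<notin> f ` {..<r}" using f by auto
      ultimately have "card S = Suc r" by (simp add: S_def card_image)
      moreover have "S \<subseteq> V" using f uv(1) by (auto simp: S_def)
      moreover have "(x, y) \<in> E" if "x \<in> S" "y \<in> S" "x \<noteq> y" for x y
      proof -
        have "(f i, f j) \<in> E" if "i < r" "j < r" "i \<noteq> j" for i j
          using f[OF that(1)] f[OF that(2)] off[of "f i" "f j"] that(3) by simp
        moreover have "(f i, u) \<in> E" if "i < r" for i using f[OF that] symE by (auto dest: symD)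
        ultimately show ?thesis using that f by (auto simp: S_def)
      qed
      ultimately show False using E(2) unfolding no_clique_def by blast
    qed
    then obtain i where i: "i < r" "\<And>x. x \<in> V \<Longrightarrow> x \<noteq> u \<Longrightarrow> c x = i \<Longrightarrow> (u, x) \<notin> E" by blast
    let ?c = "c(u := i)"
    have "E \<subseteq> col_edges V ?c"
    proof
      fix e assume e: "e \<in> E"
      obtain x y where xy: "e = (x, y)" by fastforce
      have "x \<in> V" "y \<in> V" "x \<noteq> y" "(y, x) \<in> E"
        using e E(1) unfolding xy is_graph_def irrefl_def by (auto dest: symD)
      then have "?c x \<noteq> ?c y" using e i(2) off unfolding xy by auto
      then show "e \<in> col_edges V ?c" using \<open>x \<in> V\<close> \<open>y \<in> V\<close> by (simp add: xy col_edges_def)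
    qed
    moreover have "?c ` V \<subseteq> {..<r}" using cr i(1) by auto
    ultimately show ?thesis using extremal_eq_if_sub_colouring[OF less.prems] by blast
  qed
qed

end

section \<open>The Turan graph\<close>

lemma multiset_two_values:
  assumes "set_mset M \<subseteq> {q, Suc q}"
  shows "M = replicate_mset (count M q) q + replicate_mset (count M (Suc q)) (Suc q)"
proof (rule multiset_eqI)
  fix x
  show "count M x = count (replicate_mset (count M q) q + replicate_mset (count M (Suc q)) (Suc q)) x"
    using assms by (cases "x \<in># M") (auto simp: not_in_iff)
qed

lemma set_mset_two_values:
  assumes "M \<noteq> {#}" "\<And>x y. x \<in># M \<Longrightarrow> y \<in># M \<Longrightarrow> x \<le> y + (1 :: nat)"
  obtains q where "q \<in># M" "set_mset M \<subseteq> {q, Suc q}"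
proof -
  have q: "Min (set_mset M) \<in># M" using assms(1) by simp
  moreover have "set_mset M \<subseteq> {Min (set_mset M), Suc (Min (set_mset M))}"
  proof
    fix x assume x: "x \<in># M"
    have "Min (set_mset M) \<le> x" "x \<le> Min (set_mset M) + 1" using x assms(2)[OF x q] by auto
    then show "x \<in> {Min (set_mset M), Suc (Min (set_mset M))}" by auto
  qed
  ultimately show ?thesis using that by blast
qed

text \<open>
  With \<open>q\<close> the smallest element, all elements are \<open>q\<close> or \<open>q + 1\<close>, so \<open>q\<close> and the number of elements
  \<open>q + 1\<close> are quotient and remainder of the sum on division by the size.
\<close>

lemma balanced_multiset_unique:
  assumes "size M = size N" "sum_mset M = sum_mset N"
    and M: "\<And>x y. x \<in># M \<Longrightarrow> y \<in># M \<Longrightarrow> x \<le> y + (1 :: nat)"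
    and N: "\<And>x y. x \<in># N \<Longrightarrow> y \<in># N \<Longrightarrow> x \<le> y + 1"
  shows "M = N"
proof (cases "M = {#}")
  case True
  then show ?thesis using assms(1) by simp
next
  case False
  have *: "\<exists>q a b. 0 < a \<and> L = replicate_mset a q + replicate_mset b (Suc q)"
    if L: "L \<noteq> {#}" "\<And>x y. x \<in># L \<Longrightarrow> y \<in># L \<Longrightarrow> x \<le> y + (1 :: nat)" for L
  proof -
    obtain q where q: "q \<in># L" "set_mset L \<subseteq> {q, Suc q}" using set_mset_two_values[OF L] by blast
    have "0 < count L q" using q(1) by simp
    then show ?thesis using multiset_two_values[OF q(2)] by blast
  qed
  have "N \<noteq> {#}" using False assms(1) by auto
  obtain q a b where 1: "0 < a" "M = replicate_mset a q + replicate_mset b (Suc q)" using *[OF False M] by blast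
  obtain q' a' b' where 2: "0 < a'" "N = replicate_mset a' q' + replicate_mset b' (Suc q')"
    using *[OF \<open>N \<noteq> {#}\<close> N] by blast
  have size: "a + b = a' + b'" using assms(1) 1 2 by simp
  have "sum_mset M = (a + b) * q + b" "sum_mset N = (a + b) * q' + b'"
  proof -
    show "sum_mset M = (a + b) * q + b" unfolding 1(2) by (simp add: algebra_simps)
    show "sum_mset N = (a + b) * q' + b'" unfolding 2(2) size by (simp add: algebra_simps)
  qed
  then have eq: "(a + b) * q + b = (a + b) * q' + b'" using assms(2) by simp
  have b: "b < a + b" "b' < a + b" using 1 2 size by auto
  have "((a + b) * q + b) div (a + b) = q" "((a + b) * q' + b') div (a + b) = q'" using b by auto
  then have "q = q'" unfolding eq by simp
  then have "b = b'" using eq by simp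
  with \<open>q = q'\<close> show ?thesis using 1 2 size by simp
qed

lemma complete_balanced_partiteE:
  assumes "complete_balanced_partite r G"
  obtains P where "pair_graph G" "partition_on (pverts G) P" "card P = r" "parcs G = join_edges P"
    "\<forall>A\<in>P. \<forall>B\<in>P. card A \<le> card B + 1"
proof -
  obtain P where P: "pair_graph G" "partition_on (pverts G) P" "card P = r"
    "parcs G = {(u, v). u \<in> pverts G \<and> v \<in> pverts G \<and> \<not> (\<exists>A\<in>P. u \<in> A \<and> v \<in> A)}"
    "\<forall>A\<in>P. \<forall>B\<in>P. card A \<le> card B + 1"
    using assms unfolding complete_balanced_partite_def by blast
  have U: "pverts G = \<Union>P" "disjoint P" using P(2) by (auto simp: partition_on_def)
  have "parcs G = join_edges P"
  proof (intro set_eqI iffI)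
    fix e assume "e \<in> parcs G"
    then obtain u v where e: "e = (u, v)" "u \<in> \<Union>P" "v \<in> \<Union>P" "\<not> (\<exists>A\<in>P. u \<in> A \<and> v \<in> A)"
      unfolding P(4) U by blast
    then obtain A B where "A \<in> P" "u \<in> A" "B \<in> P" "v \<in> B" "A \<noteq> B" by blast
    then show "e \<in> join_edges P" unfolding e(1) join_edges_def by blast
  next
    fix e assume "e \<in> join_edges P"
    then obtain u v A B where e: "e = (u, v)" "A \<in> P" "B \<in> P" "A \<noteq> B" "u \<in> A" "v \<in> B"
      by (auto simp: join_edges_def)
    have "C = A" if "C \<in> P" "u \<in> C" for C using U(2) e that by (auto simp: disjoint_def)
    moreover have "C = B" if "C \<in> P" "v \<in> C" for C using U(2) e that by (auto simp: disjoint_def)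
    ultimately have "\<not> (\<exists>C\<in>P. u \<in> C \<and> v \<in> C)" using e(4) by blast
    then show "e \<in> parcs G" unfolding P(4) U using e by blast
  qed
  then show ?thesis using that P by blast
qed

lemma complete_balanced_partite_iso:
  fixes G :: "'a pair_pre_digraph" and H :: "'b pair_pre_digraph"
  assumes "complete_balanced_partite r G" "complete_balanced_partite r H"
    and "card (pverts G) = card (pverts H)"
  shows "digraph_iso (with_proj G) (with_proj H)"
proof -
  obtain P where P: "pair_graph G" "partition_on (pverts G) P" "card P = r" "parcs G = join_edges P"
    "\<forall>A\<in>P. \<forall>B\<in>P. card A \<le> card B + 1"
    by (rule complete_balanced_partiteE[OF assms(1)])
  obtain Q where Q: "pair_graph H" "partition_on (pverts H) Q" "card Q = r" "parcs H = join_edges Q"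
    "\<forall>A\<in>Q. \<forall>B\<in>Q. card A \<le> card B + 1"
    by (rule complete_balanced_partiteE[OF assms(2)])
  have fin: "finite (pverts G)" "finite (pverts H)" using P Q by (auto simp: pair_graph_iff is_graph_def)
  have finP: "finite P" "finite Q" using finite_elements fin P Q by blast+
  have U: "\<Union>P = pverts G" "disjoint P" "\<Union>Q = pverts H" "disjoint Q"
    using P(2) Q(2) by (auto simp: partition_on_def)
  have finA: "finite A" if "A \<in> P" for A using U fin that by (metis Union_upper finite_subset)
  have finB: "finite B" if "B \<in> Q" for B using U fin that by (metis Union_upper finite_subset)
  have "sum_mset (shape P) = card (\<Union>P)"
    using U(2) finA by (simp add: shape_def card_Union_disjoint disjoint_def pairwise_def disjnt_def sum_unfold_sum_mset)
  moreover have "sum_mset (shape Q) = card (\<Union>Q)"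
    using U(4) finB by (simp add: shape_def card_Union_disjoint disjoint_def pairwise_def disjnt_def sum_unfold_sum_mset)
  ultimately have "shape P = shape Q"
    using P(3,5) Q(3,5) U(1,3) assms(3) finP
    by (intro balanced_multiset_unique) (auto simp: shape_def)
  then obtain f where f: "inj_on f (\<Union>P)" "Q = (`) f ` P"
    using same_shape_bij[OF finP U(2,4) finA finB] by blast
  have "pverts H = f ` pverts G" unfolding U(1,3)[symmetric] f(2) by blast
  moreover have "parcs H = map_prod f f ` parcs G"
    unfolding P(4) Q(4) f(2) by (rule join_edges_image[OF f(1)])
  ultimately show ?thesis unfolding digraph_iso_iff[OF P(1)] using f(1) U(1) by metis
qed

lemma complete_balanced_partite_col_edges:
  assumes V: "finite V" "r \<le> card V" and c: "balanced r V c"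
  shows "complete_balanced_partite r \<lparr>pverts = V, parcs = col_edges V c\<rparr>"
proof -
  let ?P = "classes r c V"
  have cr: "c ` V \<subseteq> {..<r}" using c by (simp add: balanced_def)
  have ne: "{x \<in> V. c x = i} \<noteq> {}" if "i < r" for i
  proof
    assume "{x \<in> V. c x = i} = {}"
    then have "card {x \<in> V. c x = i} = 0" by (simp only: card.empty)
    then show False using balanced_class_large[OF V(1) c, of 1 i] that V(2) by simp
  qed
  have "inj_on (\<lambda>i. {x \<in> V. c x = i}) {..<r}"
  proof (rule inj_onI)
    fix i j assume "i \<in> {..<r}" "{x \<in> V. c x = i} = {x \<in> V. c x = j}"
    with ne[of i] show "i = j" by blast
  qed
  then have card: "card ?P = r" by (simp add: classes_def card_image)
  have part: "partition_on V ?P"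
  proof (rule partition_onI)
    show "\<Union>?P = V" by (rule Union_classes[OF cr])
    show "{} \<notin> ?P" using ne unfolding classes_def by blast
  qed (auto simp: classes_def disjnt_def)
  have edges: "col_edges V c = {(u, v). u \<in> V \<and> v \<in> V \<and> \<not> (\<exists>A\<in>?P. u \<in> A \<and> v \<in> A)}"
  proof -
    have "(\<exists>A\<in>?P. u \<in> A \<and> v \<in> A) \<longleftrightarrow> c u = c v" if "u \<in> V" "v \<in> V" for u v
      using that cr by (auto simp: classes_def)
    then show ?thesis unfolding col_edges_def by blast
  qed
  have close: "\<forall>A\<in>?P. \<forall>B\<in>?P. card A \<le> card B + 1"
    using c by (auto simp: classes_def balanced_def)
  show ?thesis
    unfolding complete_balanced_partite_def pair_graph_iff pair_pre_digraph.simps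
    by (intro conjI exI[of _ ?P] is_graph_col_edges V(1) part card edges close)
qed

lemma ex_extremal:
  assumes "finite V" "1 \<le> r"
  shows "\<exists>E. extremal M (Suc r) V E"
proof -
  let ?ok = "\<lambda>E. is_graph V E \<and> no_clique (Suc r) V E"
  have "no_clique (Suc r) V {}"
    unfolding no_clique_def
  proof
    assume "\<exists>S\<subseteq>V. card S = Suc r \<and> (\<forall>x\<in>S. \<forall>y\<in>S. x \<noteq> y \<longrightarrow> (x, y) \<in> {})"
    then obtain S where S: "S \<subseteq> V" "card S = Suc r" "\<forall>x\<in>S. \<forall>y\<in>S. x \<noteq> y \<longrightarrow> (x, y) \<in> {}" by blast
    from S(3) have "\<forall>x\<in>S. \<forall>y\<in>S. x = y" by auto
    then have "card S \<le> Suc 0" by (metis card_le_Suc0_iff_eq card.infinite zero_le)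
    then show False using S(2) assms(2) by simp
  qed
  then have "?ok {}" using assms(1) by (simp add: is_graph_def irrefl_def sym_def)
  moreover have "\<forall>E. ?ok E \<longrightarrow> card (part_copies M V E) < Suc (card (Pow (Pow V)))"
    using assms(1) by (intro allI impI le_imp_less_Suc card_mono) (simp, unfold part_copies_def, blast)
  ultimately have "\<exists>E. ?ok E \<and> (\<forall>E'. ?ok E' \<longrightarrow> card (part_copies M V E') \<le> card (part_copies M V E))"
    by (rule ex_has_greatest_nat)
  then show ?thesis unfolding extremal_def by blast
qed

lemma turan_graph_col_edges: "parcs (turan_graph r n) = col_edges {..<n} (\<lambda>i. i mod r)"
  unfolding turan_graph_def col_edges_def by (simp only: pair_pre_digraph.simps lessThan_iff)

text \<open>
  Every extremal graph, on whatever vertex set, is a balanced coloured graph and thus isomorphic to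
  the Turan graph. Hence the Turan graph attains the maximum, and nothing else does. If \<open>r = 2\<close> the
  two classes exhaust the vertices, which is how a lower bound on \<open>n\<close> can enter \<open>step\<close>.
\<close>

lemma turan_graph_maximizes_uniquely:
  fixes T :: "'a pair_pre_digraph"
  assumes T: "pair_graph T" "partition_on (pverts T) PT" "parcs T = join_edges PT" "card PT = r"
    and r: "2 \<le> r" and m: "\<And>A. A \<in> PT \<Longrightarrow> card A \<le> m" and n: "r * Suc m \<le> n"
    and step: "\<And>K p q a b. \<lbrakk>K + {#p, q#} = shape PT; b < a; r = 2 \<Longrightarrow> Suc a + b = n;
        0 < pair_choices p q (Suc a) b\<rbrakk> \<Longrightarrow> pair_choices p q (Suc a) b < pair_choices p q a (Suc b)"
  shows "maximizes_copies T (r + 1) n (turan_graph r n) \<and>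
    (\<forall>G. maximizes_copies T (r + 1) n G \<longrightarrow> digraph_iso (with_proj G) (with_proj (turan_graph r n)))"
proof -
  let ?M = "shape PT" and ?T = "turan_graph r n"
  have finT: "finite (pverts T)" using T(1) by (simp add: pair_graph_iff is_graph_def)
  have finP: "finite PT" by (rule finite_elements[OF finT T(2)])
  have M: "size ?M = r" "0 \<notin># ?M" "\<And>p. p \<in># ?M \<Longrightarrow> p \<le> m"
    using T(4) m finP shape_partition_on[OF T(2) finT] by (auto simp: shape_def)
  have rn: "r \<le> n" using n r by simp
  have num: "num_copies T G = card (part_copies ?M (pverts G) (parcs G))"
    if "pair_graph G" for G :: "nat pair_pre_digraph"
    by (rule num_copies_eq_card_part_copies[OF T(1-3) that])
  have iso: "digraph_iso (with_proj G) (with_proj ?T)"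
    if G: "extremal ?M (Suc r) (pverts G) (parcs G)" "card (pverts G) = n" for G :: "nat pair_pre_digraph"
  proof -
    have V: "finite (pverts G)" using G by (simp add: extremal_def is_graph_def)
    obtain c where c: "balanced r (pverts G) c" "parcs G = col_edges (pverts G) c"
      using extremal_is_balanced_colouring[OF r M V _ _ G(1)] n step unfolding G(2) by blast
    have "complete_balanced_partite r \<lparr>pverts = pverts G, parcs = parcs G\<rparr>"
      unfolding c(2) by (rule complete_balanced_partite_col_edges[OF V _ c(1)]) (use rn G(2) in simp)
    then have "complete_balanced_partite r G" by (cases G) simp
    moreover have "complete_balanced_partite r ?T"
      using complete_balanced_partite_turan_graph r rn by simp
    ultimately show ?thesis
      by (rule complete_balanced_partite_iso) (simp add: G(2) card_pverts_turan_graph)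
  qed
  have T_ok: "pair_graph ?T" "clique_free (r + 1) ?T"
  proof -
    show pg: "pair_graph ?T"
      using complete_balanced_partite_turan_graph[of r n] r rn by (simp add: complete_balanced_partite_def)
    have "no_clique (Suc r) {..<n} (col_edges {..<n} (\<lambda>i. i mod r))"
      by (rule no_clique_col_edges) (use r in auto)
    then show "clique_free (r + 1) ?T"
      unfolding clique_free_iff[OF pg] turan_graph_col_edges by (simp add: turan_graph_def)
  qed
  have "num_copies T H \<le> num_copies T ?T"
    if H: "pair_graph H" "card (pverts H) = n" "clique_free (r + 1) H" for H :: "nat pair_pre_digraph"
  proof -
    have V: "finite (pverts H)" using H(1) by (simp add: pair_graph_iff is_graph_def)
    obtain E where E: "extremal ?M (Suc r) (pverts H) E" using ex_extremal[OF V] r by fastforce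
    define G where "G = \<lparr>pverts = pverts H, parcs = E\<rparr>"
    have G: "pair_graph G" using E by (simp add: pair_graph_iff G_def extremal_def)
    have "num_copies T H \<le> card (part_copies ?M (pverts G) (parcs G))"
      using E H num[OF H(1)] clique_free_iff[OF H(1)]
      by (simp add: extremal_def pair_graph_iff G_def)
    also have "\<dots> \<le> num_copies T ?T"
    proof -
      have "digraph_iso (with_proj G) (with_proj ?T)" using E H(2) by (intro iso) (simp_all add: G_def)
      then obtain f where f: "inj_on f (pverts G)" "pverts ?T = f ` pverts G" "parcs ?T = map_prod f f ` parcs G"
        unfolding digraph_iso_iff[OF G] by blast
      show ?thesis unfolding num[OF T_ok(1)] f(2,3)
        by (rule card_part_copies_image[OF f(1)]) (use G in \<open>auto simp: pair_graph_iff is_graph_def\<close>)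
    qed
    finally show ?thesis .
  qed
  then have "maximizes_copies T (r + 1) n ?T"
    using T_ok by (simp add: maximizes_copies_def card_pverts_turan_graph)
  moreover have "digraph_iso (with_proj G) (with_proj ?T)" if "maximizes_copies T (r + 1) n G" for G
  proof (rule iso)
    have G: "pair_graph G" "card (pverts G) = n" "clique_free (r + 1) G"
      and max: "\<And>H :: nat pair_pre_digraph. pair_graph H \<Longrightarrow> card (pverts H) = n \<Longrightarrow> clique_free (r + 1) H
        \<Longrightarrow> num_copies T H \<le> num_copies T G"
      using that unfolding maximizes_copies_def by blast+
    show "card (pverts G) = n" by fact
    have "card (part_copies ?M (pverts G) E) \<le> card (part_copies ?M (pverts G) (parcs G))"
      if "is_graph (pverts G) E" "no_clique (Suc r) (pverts G) E" for E
    proof -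
      have pg: "pair_graph \<lparr>pverts = pverts G, parcs = E\<rparr>" using that by (simp add: pair_graph_iff)
      then show ?thesis using max[OF pg] that(2) G(2) num[OF pg] num[OF G(1)] clique_free_iff[OF pg] by simp
    qed
    then show "extremal ?M (Suc r) (pverts G) (parcs G)"
      using G(1,3) clique_free_iff[OF G(1)] by (simp add: extremal_def pair_graph_iff)
  qed
  ultimately show ?thesis by blast
qed

lemma complete_bipartite_parts:
  assumes "complete_bipartite_digraph s t (with_proj T)" "1 \<le> s" "1 \<le> t"
  obtains P where "pair_graph T" "partition_on (pverts T) P" "parcs T = join_edges P" "card P = 2"
    "shape P = {#s, t#}"
proof -
  obtain U V where UV: "finite (pverts T)" "pverts T = U \<union> V" "U \<inter> V = {}" "card U = s" "card V = t"
    "parcs T = U \<times> V \<union> V \<times> U"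
    using assms(1) unfolding complete_bipartite_digraph_pair_def by blast
  have "U \<noteq> {}" "V \<noteq> {}" using UV(4,5) assms(2,3) by auto
  then have "U \<noteq> V" using UV(3) by auto
  have "partition_on (pverts T) {U, V}"
    by (rule partition_onI) (use UV \<open>U \<noteq> {}\<close> \<open>V \<noteq> {}\<close> in \<open>auto simp: disjnt_def\<close>)
  moreover have "parcs T = join_edges {U, V}"
    unfolding UV(6) join_edges_def using \<open>U \<noteq> V\<close> by auto
  ultimately show ?thesis
    using that[of "{U, V}"] pair_graphI_complete_bipartite[OF assms(1)] \<open>U \<noteq> V\<close> UV(4,5)
    by (simp add: shape_def)
qed

lemma card_mod_2_classes:
  "card {i \<in> {..<n}. i mod 2 = (0::nat)} = Suc n div 2" "card {i \<in> {..<n}. i mod 2 = (1::nat)} = n div 2"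
proof (induction n)
  case (Suc n)
  have ins: "{i \<in> {..<Suc n}. i mod 2 = k} = (if n mod 2 = k then insert n else id) {i \<in> {..<n}. i mod 2 = k}" for k
    by (auto simp: less_Suc_eq)
  { case 1 then show ?case using Suc by (simp only: ins) (cases "even n"; simp; presburger)
  next
    case 2 then show ?case using Suc by (simp only: ins) (cases "even n"; simp; presburger)}
qed simp_all

text \<open>
  Moving one vertex from the smaller class to the larger one gives a graph with more copies.
  The difference \<open>P - Q\<close> is 1 for even \<open>n\<close> and 2 for odd \<open>n\<close>.
\<close>

lemma turan_graph_not_maximizing:
  assumes T: "complete_bipartite_digraph s t (with_proj T)" and s: "1 \<le> s"
    and t: "t = s + k" "k = Suc m" "1 \<le> m" "2 * s \<le> m * k" and n: "2 * t + 2 \<le> n"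
  shows "\<not> maximizes_copies T 3 n (turan_graph 2 n)"
proof -
  obtain PT where PT: "pair_graph T" "partition_on (pverts T) PT" "parcs T = join_edges PT" "shape PT = {#s, t#}"
    using complete_bipartite_parts[OF T s trans_le_add1[OF s, of k, folded t(1)]] by blast
  define c where "c = (\<lambda>i::nat. i mod 2)"
  \<comment> \<open>vertex 1 moves from the smaller class, the odd numbers, to the larger one\<close>
  define c' where "c' = c(1 := 0)"
  define P where "P = Suc n div 2 - s"
  define Q where "Q = n div 2 - 1 - s"
  have PQ: "Suc n div 2 = P + s" "n div 2 = Suc (Q + s)" "Q < P" "P \<le> Q + 2" "k \<le> P"
  proof -
    have "t + 1 \<le> n div 2" using div_le_mono[OF n, of 2] by simp
    moreover have "n div 2 \<le> Suc n div 2" "Suc n div 2 \<le> Suc (n div 2)" by simp_all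
    ultimately show "Suc n div 2 = P + s" "n div 2 = Suc (Q + s)" "Q < P" "P \<le> Q + 2" "k \<le> P"
      using t(1,2) unfolding P_def Q_def by arith+
  qed
  have c: "c ` {..<n} \<subseteq> {..<2}" "c' ` {..<n} \<subseteq> {..<2}" by (auto simp: c_def c'_def)
  have count: "card (part_copies {#s, t#} {..<n} (col_edges {..<n} d)) =
      pair_choices s t (card {x \<in> {..<n}. d x = 0}) (card {x \<in> {..<n}. d x = 1})"
    if "d ` {..<n} \<subseteq> {..<2}" for d
  proof -
    have M: "size {#s, t#} = 2" "0 \<notin># {#s, t#}" using s t(1) by auto
    show ?thesis
      unfolding card_part_copies_col_edges[OF finite_lessThan that M]
      by (rule card_col_sets_two[OF finite_lessThan that])
  qed
  have sz: "card {x \<in> {..<n}. c x = 0} = P + s" "card {x \<in> {..<n}. c x = 1} = Suc (Q + s)"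
    using card_mod_2_classes[of n] PQ(1,2) by (simp_all add: c_def)
  have "{x \<in> {..<n}. c' x = 0} = insert 1 {x \<in> {..<n}. c x = 0}"
    "{x \<in> {..<n}. c' x = 1} = {x \<in> {..<n}. c x = 1} - {1}" using n by (auto simp: c'_def)
  moreover have "1 \<notin> {x \<in> {..<n}. c x = 0}" "1 \<in> {x \<in> {..<n}. c x = 1}" using n by (auto simp: c_def)
  ultimately have sz': "card {x \<in> {..<n}. c' x = 0} = Suc (P + s)" "card {x \<in> {..<n}. c' x = 1} = Q + s"
    using sz by simp_all
  have less: "card (part_copies {#s, t#} {..<n} (col_edges {..<n} c))
      < card (part_copies {#s, t#} {..<n} (col_edges {..<n} c'))"
    unfolding count[OF c(1)] count[OF c(2)] sz sz'
    by (rule pair_choices_unbalance_wide[OF t(2,3,4) PQ(3-5), folded t(1)])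
  define H where "H = \<lparr>pverts = {..<n}, parcs = col_edges {..<n} c'\<rparr>"
  have H: "pair_graph H" by (simp add: H_def pair_graph_iff is_graph_col_edges)
  have H3: "clique_free 3 H"
    using no_clique_col_edges[OF c(2)] unfolding clique_free_iff[OF H] by (simp add: H_def numeral_3_eq_3 numeral_2_eq_2)
  have more: "num_copies T (turan_graph 2 n) < num_copies T H" if "pair_graph (turan_graph 2 n)"
    unfolding num_copies_eq_card_part_copies[OF PT(1-3) H] num_copies_eq_card_part_copies[OF PT(1-3) that]
      turan_graph_col_edges PT(4) using less by (simp add: H_def turan_graph_def c_def)
  show ?thesis
  proof
    assume max: "maximizes_copies T 3 n (turan_graph 2 n)"
    have "card (pverts H) = n" by (simp add: H_def)
    then have "num_copies T H \<le> num_copies T (turan_graph 2 n)" "pair_graph (turan_graph 2 n)"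
      using max H H3 unfolding maximizes_copies_def by simp_all
    with more show False by simp
  qed
qed

text \<open>
  Part sizes that differ by at most one are balanced anyway. Otherwise the larger class has at least
  half of the vertices, and so it satisfies the largeness condition of
  \<open>pair_choices_balance_wide\<close>.
\<close>

lemma turan_graph_maximizing_bipartite:
  assumes T: "complete_bipartite_digraph s t (with_proj T)" and s: "1 \<le> s" "s \<le> t"
    and t: "t = s \<or> (t - s - 1) * (t - s) < 2 * s"
  shows "\<exists>n0. \<forall>n\<ge>n0. maximizes_copies T 3 n (turan_graph 2 n)"
proof -
  obtain PT where PT: "pair_graph T" "partition_on (pverts T) PT" "parcs T = join_edges PT" "card PT = 2"
    and sh: "shape PT = {#s, t#}"
    using complete_bipartite_parts[OF T s(1) order.trans[OF s]] by blast
  define k where "k = t - s"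
  define m where "m = k - 1"
  define X where "X = m * k * (1 + s) + 2 * s * m + k"
  \<comment> \<open>the larger of two classes exhausting \<open>n \<ge> n0\<close> vertices has more than \<open>X + s\<close> of them\<close>
  define n0 where "n0 = 2 * (X + s + t + 1)"
  have "finite (pverts T)" using PT(1) by (simp add: pair_graph_iff is_graph_def)
  then have "finite PT" using finite_elements PT(2) by blast
  then have part_le: "card A \<le> t" if "A \<in> PT" for A
  proof -
    have "card A \<in># shape PT" using that \<open>finite PT\<close> by (simp add: shape_def)
    then show ?thesis using s unfolding sh by auto
  qed
  have "maximizes_copies T 3 n (turan_graph 2 n)" if n: "n0 \<le> n" for n
  proof -
    have step: "pair_choices s t (Suc a) b < pair_choices s t a (Suc b)"
      if ab: "b < a" "Suc a + b = n" "0 < pair_choices s t (Suc a) b" for a b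
    proof (cases "t \<le> Suc s")
      case True
      then show ?thesis using ab s by (intro pair_choices_balance_consecutive[of s]) auto
    next
      case False
      then have k: "k = Suc m" "1 \<le> m" "m * k < 2 * s" "t = s + k"
        using t s(2) by (auto simp: k_def m_def)
      have "s \<le> b"
      proof (rule ccontr)
        assume "\<not> s \<le> b"
        then show False using ab(3) s(2) by (simp add: pair_choices_def split: if_splits)
      qed
      have "X + s + 1 \<le> a" using n ab(1,2) unfolding n0_def by arith
      then have "m * k * (1 + s) + 2 * s * m + k < a - s" unfolding X_def[symmetric] by linarith
      then have "pair_choices s (s + k) (Suc (a - s + s)) (b - s + s) < pair_choices s (s + k) (a - s + s) (Suc (b - s + s))"
        using ab(1) \<open>s \<le> b\<close> by (intro pair_choices_balance_wide[OF k(1-3)]) auto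
      then show ?thesis using ab(1) \<open>s \<le> b\<close> k(4) by simp
    qed
    have "maximizes_copies T (2 + 1) n (turan_graph 2 n) \<and>
      (\<forall>G. maximizes_copies T (2 + 1) n G \<longrightarrow> digraph_iso (with_proj G) (with_proj (turan_graph 2 n)))"
    proof (rule turan_graph_maximizes_uniquely[OF PT order_refl part_le])
      show "2 * Suc t \<le> n" using n by (simp add: n0_def)
      fix K p q a b
      assume K: "K + {#p, q#} = shape PT" and ab: "b < a" "2 = (2::nat) \<Longrightarrow> Suc a + b = n"
        and pos: "0 < pair_choices p q (Suc a) b"
      have "size (K + {#p, q#}) = 2" unfolding K sh by simp
      then have "K = {#}" by simp
      then have "{#p, q#} = {#s, t#}" using K sh by simp
      then have "p = s \<and> q = t \<or> p = t \<and> q = s" by (auto simp: add_eq_conv_diff)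
      then have eq: "pair_choices p q x y = pair_choices s t x y" for x y
        using pair_choices_commute by auto
      show "pair_choices p q (Suc a) b < pair_choices p q a (Suc b)"
        using step[OF ab(1) ab(2)[OF refl]] pos unfolding eq .
    qed
    then show ?thesis by simp
  qed
  then show ?thesis by blast
qed

lemma turan_graph_maximizes_balanced:
  assumes r: "2 \<le> r" and T: "complete_balanced_partite r T"
  shows "\<exists>n0. \<forall>n\<ge>n0. maximizes_copies T (r + 1) n (turan_graph r n) \<and>
    (\<forall>G. maximizes_copies T (r + 1) n G \<longrightarrow> digraph_iso (with_proj G) (with_proj (turan_graph r n)))"
proof -
  obtain P where P: "pair_graph T" "partition_on (pverts T) P" "card P = r" "parcs T = join_edges P"
    "\<forall>A\<in>P. \<forall>B\<in>P. card A \<le> card B + 1"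
    by (rule complete_balanced_partiteE[OF T])
  have finT: "finite (pverts T)" using P(1) by (simp add: pair_graph_iff is_graph_def)
  have finP: "finite P" by (rule finite_elements[OF finT P(2)])
  have in_shape: "card A \<in># shape P" if "A \<in> P" for A using that finP by (simp add: shape_def)
  have "x \<le> y + 1" if "x \<in># shape P" "y \<in># shape P" for x y
    using that P(5) finP by (auto simp: shape_def)
  moreover have "shape P \<noteq> {#}" using P(3) r finP by (auto simp: shape_def mset_set_empty_iff)
  ultimately obtain k where k: "k \<in># shape P" "set_mset (shape P) \<subseteq> {k, Suc k}"
    using set_mset_two_values by blast
  have "1 \<le> k" using k(1) shape_partition_on[OF P(2) finT] by (cases k) auto
  show ?thesis
  proof (intro exI allI impI)
    fix n assume n: "r * Suc (Suc k) \<le> n"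
    show "maximizes_copies T (r + 1) n (turan_graph r n) \<and>
      (\<forall>G. maximizes_copies T (r + 1) n G \<longrightarrow> digraph_iso (with_proj G) (with_proj (turan_graph r n)))"
    proof (rule turan_graph_maximizes_uniquely[OF P(1,2,4,3) r _ n])
      show "card A \<le> Suc k" if "A \<in> P" for A using in_shape[OF that] k(2) by auto
      fix K p q a b
      assume "K + {#p, q#} = shape P" and ab: "b < a" "0 < pair_choices p q (Suc a) b"
      then have "p \<in># shape P" "q \<in># shape P" by (metis union_iff insert_noteq_member add_mset_commute set_mset_add_mset_insert insertI1)+
      then have "p \<in> {k, Suc k}" "q \<in> {k, Suc k}" using k(2) by auto
      then show "pair_choices p q (Suc a) b < pair_choices p q a (Suc b)"
        by (rule pair_choices_balance_consecutive[OF \<open>1 \<le> k\<close> _ _ ab])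
    qed
  qed
qed

theorem theorem1p5:
  shows "(\<forall>(r::nat) (T :: 'a pair_pre_digraph). r \<ge> 2 \<and> complete_balanced_partite r T \<longrightarrow>
            (\<exists>n0. \<forall>n\<ge>n0.
               maximizes_copies T (r + 1) n (turan_graph r n) \<and>
               (\<forall>G. maximizes_copies T (r + 1) n G \<longrightarrow>
                    digraph_iso (with_proj G) (with_proj (turan_graph r n)))))
       \<and> (\<forall>(s::nat) (t::nat) (T :: 'a pair_pre_digraph).
            1 \<le> s \<and> s \<le> t \<and> complete_bipartite_digraph s t (with_proj T) \<longrightarrow>
            (\<exists>n0. \<forall>n\<ge>n0.
               maximizes_copies T 3 n (turan_graph 2 n) \<longleftrightarrow>
               real t < real s + 1 / 2 + sqrt (2 * real s + 1 / 4)))"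
proof (intro conjI allI impI; elim conjE)
  fix r :: nat and T :: "'a pair_pre_digraph"
  assume "2 \<le> r" "complete_balanced_partite r T"
  then show "\<exists>n0. \<forall>n\<ge>n0. maximizes_copies T (r + 1) n (turan_graph r n) \<and>
    (\<forall>G. maximizes_copies T (r + 1) n G \<longrightarrow> digraph_iso (with_proj G) (with_proj (turan_graph r n)))"
    by (rule turan_graph_maximizes_balanced)
next
  fix s t :: nat and T :: "'a pair_pre_digraph"
  assume s: "1 \<le> s" "s \<le> t" and T: "complete_bipartite_digraph s t (with_proj T)"
  show "\<exists>n0. \<forall>n\<ge>n0. maximizes_copies T 3 n (turan_graph 2 n) \<longleftrightarrow>
    real t < real s + 1 / 2 + sqrt (2 * real s + 1 / 4)"
  proof (cases "t = s \<or> (t - s - 1) * (t - s) < 2 * s")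
    case True
    then show ?thesis
      using turan_graph_maximizing_bipartite[OF T s True] sqrt_condition_iff[OF s(2)] by simp
  next
    case False
    define k where "k = t - s"
    have k: "t = s + k" "k = Suc (k - 1)" "1 \<le> k - 1" "2 * s \<le> (k - 1) * k"
    proof -
      show "t = s + k" "k = Suc (k - 1)" "2 * s \<le> (k - 1) * k" using False s(2) by (auto simp: k_def)
      then show "1 \<le> k - 1" using s(1) by (cases "k - 1") auto
    qed
    have "\<not> maximizes_copies T 3 n (turan_graph 2 n)" if "2 * t + 2 \<le> n" for n
      by (rule turan_graph_not_maximizing[OF T s(1) k that])
    then show ?thesis using False sqrt_condition_iff[OF s(2)] by blast
  qed
qed

end
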